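(* Let $d\ge 1$ and let $V(x)=g(|x|)$, $x\in\mathbb{R}^d$, for some increasing function $g:[0,\infty)\to[0,\infty)$ such that $g(r)\to\infty$ as $r\to\infty$. Let $\varphi_0$ be the ground state of the Schrödinger operator $H=-\Delta+V$ in $L^2(\mathbb{R}^d)$. Then the following hold. (I) If for every $\varepsilon>0$ there exist $\delta,t_0>0$ satisfying $$g((1+\delta)t)\le(1+\varepsilon)\,g(t),\qquad t>t_0,$$ then for every $\varepsilon>0$ there are $c,r>0$ such that $$\varphi_0(x)\ge c\,\exp\left(-(1+\varepsilon)\sqrt{V(x)}\,|x|\right),\qquad |x|\ge r.$$ (II) If for every $\varepsilon,\delta\in(0,1)$ there exists $t_0>0$ satisfying $$g((1-\delta)t)\ge(1-\varepsilon)\,g(t),\qquad t>t_0,$$ then for every $\varepsilon\in(0,1)$ there are $c,r>0$ such that $$\varphi_0(x)\le c\,\exp\left(-(1-\varepsilon)\sqrt{V(x)}\,|x|\right),\qquad |x|\ge r.$$ If the assumptions in (I) and (II) are satisfied, then $$\lim_{|x|\to\infty}\frac{-\log\varphi_0(x)}{\varrho(x)}=1\qquad\text{with}\quad \varrho(x)=\sqrt{V(x)}\,|x|.$$ In particular, if $g$ is a function slowly varying at infinity, i.e. for every $\lambda>0$, $$\lim_{r\to\infty}\frac{g(\lambda r)}{g(r)}=1,$$ then (I) and (II) hold (that is, the estimates in (I) and (II) are valid). Moreover, if $g$ grows at infinity at most linearly fast, e.g. $$g(r)=ar^{\alpha}+b,\qquad\text{with }\alpha>0\text{ and }a,b>0,$$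 then (I) holds as well (that is, the estimate in (I) is valid).
   Context: $\Delta$ is the classical Laplacian on $\mathbb{R}^d$, and $H=-\Delta+V$ acts in $L^2(\mathbb{R}^d)$. The ground state $\varphi_0$ of $H$ is the unique (up to a multiplicative constant) eigenfunction corresponding to the eigenvalue $\lambda_0:=\inf\sigma(H)>0$; it is taken to be bounded, continuous and strictly positive on $\mathbb{R}^d$. *)

theory Defs
  imports "HOL-Analysis.Analysis" "HOL-Library.Landau_Symbols"
begin

definition partial :: "'a::euclidean_space \<Rightarrow> ('a \<Rightarrow> complex) \<Rightarrow> 'a \<Rightarrow> complex" where
  "partial b f x = vector_derivative (\<lambda>t. f (x + t *\<^sub>R b)) (at 0)"

fun Ck :: "nat \<Rightarrow> ('a::euclidean_space \<Rightarrow> complex) \<Rightarrow> bool" where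
  "Ck 0 f \<longleftrightarrow> continuous_on UNIV f"
| "Ck (Suc k) f \<longleftrightarrow> continuous_on UNIV f \<and>
     (\<forall>b\<in>Basis. (\<forall>x. (\<lambda>t. f (x + t *\<^sub>R b)) differentiable (at (0::real))) \<and> Ck k (partial b f))"

definition test_functions :: "('a::euclidean_space \<Rightarrow> complex) set" where
  "test_functions = {\<psi>. (\<forall>k. Ck k \<psi>) \<and> compact (closure {x. \<psi> x \<noteq> 0})}"

definition laplacian :: "('a::euclidean_space \<Rightarrow> complex) \<Rightarrow> 'a \<Rightarrow> complex" where
  "laplacian f x = (\<Sum>b\<in>Basis. partial b (partial b f) x)"

text \<open>Elements of the Hilbert space are represented by functions; functions that agree
  almost everywhere represent the same element.\<close>

definition L2 :: "('a::euclidean_space \<Rightarrow> complex) set" where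
  "L2 = {f \<in> borel_measurable lborel. integrable lborel (\<lambda>x. (cmod (f x))\<^sup>2)}"

definition L2_norm :: "('a::euclidean_space \<Rightarrow> complex) \<Rightarrow> real" where
  "L2_norm f = sqrt (LINT x|lborel. (cmod (f x))\<^sup>2)"

text \<open>The graph of the operator \<open>H = -\<Delta> + V\<close> on its maximal domain: \<open>schrodinger V f h\<close> says that
  \<open>f\<close> and \<open>h\<close> are square integrable and \<open>-\<Delta> f + V f = h\<close> in the sense of distributions.
  For nonnegative, measurable and locally bounded \<open>V\<close> (as is the case for \<open>V x = g (norm x)\<close> with
  \<open>g\<close> nonnegative and increasing) all the integrals exist, and by Kato's theorem this is the
  self-adjoint operator which is the closure of \<open>-\<Delta> + V\<close> from the test functions and which is
  also given by the form sum.\<close>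

definition schrodinger ::
  "('a::euclidean_space \<Rightarrow> real) \<Rightarrow> ('a \<Rightarrow> complex) \<Rightarrow> ('a \<Rightarrow> complex) \<Rightarrow> bool" where
  "schrodinger V f h \<longleftrightarrow> f \<in> L2 \<and> h \<in> L2 \<and>
     (\<forall>\<psi>\<in>test_functions.
        (LINT x|lborel. f x * (- laplacian \<psi> x + of_real (V x) * \<psi> x)) = (LINT x|lborel. h x * \<psi> x))"

text \<open>\<open>T\<close> is the graph of an operator, i.e. \<open>T f k\<close> means that \<open>f\<close> is in the domain and is mapped
  to \<open>k\<close>. A point \<open>z\<close> is in the resolvent set if \<open>T - z\<close> is a bijection from the domain onto
  the Hilbert space with a bounded inverse; the norm bound contains injectivity.\<close>

definition resolvent_set ::
  "(('a::euclidean_space \<Rightarrow> complex) \<Rightarrow> ('a \<Rightarrow> complex) \<Rightarrow> bool) \<Rightarrow> complex set" where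
  "resolvent_set T = {z.
     (\<forall>h\<in>L2. \<exists>f k. T f k \<and> (AE x in lborel. k x - z * f x = h x)) \<and>
     (\<exists>C. \<forall>f k. T f k \<longrightarrow> L2_norm f \<le> C * L2_norm (\<lambda>x. k x - z * f x))}"

definition spectrum ::
  "(('a::euclidean_space \<Rightarrow> complex) \<Rightarrow> ('a \<Rightarrow> complex) \<Rightarrow> bool) \<Rightarrow> complex set" where
  "spectrum T = - resolvent_set T"

text \<open>The spectrum of the self-adjoint operator \<open>H\<close> is contained in the real line, so its
  infimum is that of its real points.\<close>

definition spectral_bottom :: "('a::euclidean_space \<Rightarrow> real) \<Rightarrow> real" where
  "spectral_bottom V = Inf {l. complex_of_real l \<in> spectrum (schrodinger V)}"

definition ground_state :: "('a::euclidean_space \<Rightarrow> real) \<Rightarrow> ('a \<Rightarrow> real) \<Rightarrow> bool" where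
  "ground_state V \<phi> \<longleftrightarrow>
     schrodinger V (\<lambda>x. of_real (\<phi> x)) (\<lambda>x. of_real (spectral_bottom V) * of_real (\<phi> x)) \<and>
     bounded (range \<phi>) \<and> continuous_on UNIV \<phi> \<and> (\<forall>x. \<phi> x > 0)"

definition slowly_varying :: "(real \<Rightarrow> real) \<Rightarrow> bool" where
  "slowly_varying g \<longleftrightarrow> (\<forall>l>0. ((\<lambda>r. g (l * r) / g r) \<longlongrightarrow> 1) at_top)"

definition growth_condition_I :: "(real \<Rightarrow> real) \<Rightarrow> bool" where
  "growth_condition_I g \<longleftrightarrow>
     (\<forall>\<epsilon>>0. \<exists>\<delta>>0. \<exists>t0>0. \<forall>t>t0. g ((1 + \<delta>) * t) \<le> (1 + \<epsilon>) * g t)"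

definition growth_condition_II :: "(real \<Rightarrow> real) \<Rightarrow> bool" where
  "growth_condition_II g \<longleftrightarrow>
     (\<forall>\<epsilon>\<in>{0<..<1}. \<forall>\<delta>\<in>{0<..<1}. \<exists>t0>0. \<forall>t>t0. g ((1 - \<delta>) * t) \<ge> (1 - \<epsilon>) * g t)"

definition lower_estimate :: "('a::euclidean_space \<Rightarrow> real) \<Rightarrow> ('a \<Rightarrow> real) \<Rightarrow> bool" where
  "lower_estimate V \<phi> \<longleftrightarrow>
     (\<forall>\<epsilon>>0. \<exists>c>0. \<exists>r>0. \<forall>x. norm x \<ge> r \<longrightarrow>
        \<phi> x \<ge> c * exp (- (1 + \<epsilon>) * sqrt (V x) * norm x))"

definition upper_estimate :: "('a::euclidean_space \<Rightarrow> real) \<Rightarrow> ('a \<Rightarrow> real) \<Rightarrow> bool" where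
  "upper_estimate V \<phi> \<longleftrightarrow>
     (\<forall>\<epsilon>\<in>{0<..<1}. \<exists>c>0. \<exists>r>0. \<forall>x. norm x \<ge> r \<longrightarrow>
        \<phi> x \<le> c * exp (- (1 - \<epsilon>) * sqrt (V x) * norm x))"

end

theory Submission
  imports Defs "HOL-Computational_Algebra.Polynomial"
begin

text \<open>Only the equation \<open>\<Delta> \<phi> = (V - \<lambda>) \<phi>\<close> and the positivity, continuity and boundedness of
  \<open>\<phi>\<close> matter; the value of \<open>\<lambda>\<close> is irrelevant. Mollifying \<open>\<phi>\<close> reduces the comparison with classical
  sub- and supersolutions of \<open>\<Delta> v = K v\<close>, \<open>K\<close> a constant, to the elementary maximum principle.

  For the upper bound at \<open>x\<close>, with \<open>|x| = r\<close>, one has \<open>V - \<lambda> \<ge> (1 - 2 \<delta>) g(r)\<close> on the ball of radius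
  \<open>(1 - \<delta>) r\<close> about \<open>x\<close> and compares with a multiple of \<open>exp (\<nu> sqrt (1 + |y - x|^2))\<close>.

  For the lower bound, comparison with \<open>exp (- \<nu> |y|) - exp (- \<nu> r)\<close> on \<open>1 < |y| < r\<close>, where
  \<open>V \<le> g(r)\<close>, is sharp up to the vanishing of the barrier at \<open>|y| = r\<close>. A second comparison of the same kind in
  an annulus of radius about \<open>g(r + 1) powr (- 1/2)\<close> near \<open>x\<close> repairs this at the cost of a factor of
  that order. As \<open>sqrt (g r) r\<close> is superlinear, the loss is harmless
  whenever \<open>g\<close> grows at most exponentially, which covers condition (I), linear growth and powers.\<close>

section \<open>Smooth bump functions\<close>

text \<open>Admitting every polynomial in 1/t makes the family closed under differentiation, so a
  single derivative lemma yields all orders. \<open>flat 1\<close> is the usual smooth function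
  vanishing on the left half line.\<close>

definition flat :: "real poly \<Rightarrow> real \<Rightarrow> real" where
  "flat p t = (if t > 0 then poly p (1 / t) * exp (- (1 / t)) else 0)"

text \<open>With s = 1/t one has d/dt = -s^2 d/ds, which takes p(s) exp(-s) to s^2 (p(s) - p'(s))
  exp(-s); the factor \<open>[:0, 0, 1:]\<close> is s^2.\<close>

definition flat_deriv :: "real poly \<Rightarrow> real poly" where
  "flat_deriv p = [:0, 0, 1:] * (p - pderiv p)"

lemma poly_times_exp_minus_tendsto_0:
  "((\<lambda>x::real. poly p x * exp (- x)) \<longlongrightarrow> 0) at_top"
proof -
  have "((\<lambda>x::real. \<Sum>i\<le>degree p. coeff p i * (x ^ i / exp x)) \<longlongrightarrow> (\<Sum>i\<le>degree p. coeff p i * 0)) at_top"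
    by (intro tendsto_sum tendsto_mult tendsto_const tendsto_power_div_exp_0)
  then show ?thesis
    by (simp add: poly_altdef sum_distrib_right exp_minus divide_inverse mult.assoc)
qed

lemma flat_has_derivative:
  "(flat p has_real_derivative flat (flat_deriv p) t) (at t)"
proof (cases t "0::real" rule: linorder_cases)
  case less
  have "((\<lambda>_. 0) has_real_derivative 0) (at t)" by simp
  then have "(flat p has_real_derivative 0) (at t)"
    by (rule has_field_derivative_transform_within_open[where S="{..<0}"])
       (use less in \<open>auto simp: flat_def\<close>)
  then show ?thesis using less by (simp add: flat_def)
next
  case greater
  have "((\<lambda>t. poly p (1 / t) * exp (- (1 / t))) has_real_derivative flat (flat_deriv p) t) (at t)"
    using greater unfolding flat_def flat_deriv_def
    by (auto intro!: derivative_eq_intros DERIV_chain2[OF poly_DERIV] simp: field_simps power2_eq_square)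
  then show ?thesis
    by (rule has_field_derivative_transform_within_open[where S="{0<..}"])
       (use greater in \<open>auto simp: flat_def\<close>)
next
  case equal
  have "((\<lambda>y. flat p y / y) \<longlongrightarrow> 0) (at_right 0)"
  proof -
    \<comment> \<open>Division by y costs one more factor 1/y, which \<open>pCons 0 p\<close>
      absorbs into the polynomial.\<close>
    have "((\<lambda>y. poly (pCons 0 p) (inverse y) * exp (- inverse y)) \<longlongrightarrow> 0) (at_right (0::real))"
      by (rule filterlim_compose[OF poly_times_exp_minus_tendsto_0 filterlim_inverse_at_top_right])
    then show ?thesis
      by (rule Lim_transform_eventually)
         (auto simp: eventually_at_right_field flat_def field_simps intro!: exI[of _ 1])
  qed
  moreover have "((\<lambda>y. flat p y / y) \<longlongrightarrow> 0) (at_left 0)"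
    by (rule Lim_transform_eventually[of "\<lambda>_. 0"])
       (auto simp: eventually_at_left_field flat_def intro!: exI[of _ "-1"])
  ultimately have "((\<lambda>y. flat p y / y) \<longlongrightarrow> 0) (at 0)"
    by (simp add: filterlim_split_at)
  then show ?thesis
    using equal by (simp add: has_field_derivative_iff flat_def)
qed

lemma continuous_flat: "continuous_on UNIV (flat p)"
  by (meson DERIV_continuous_on flat_has_derivative has_field_derivative_at_within)

lemma continuous_on_flat [continuous_intros]:
  "continuous_on S f \<Longrightarrow> continuous_on S (\<lambda>x. flat p (f x))"
  using continuous_on_compose2[OF continuous_flat, of S f] by auto

lemma flat_bounded_atMost:
  obtains B where "B > 0" "\<And>t. t \<le> c \<Longrightarrow> \<bar>flat p t\<bar> \<le> B"
proof -
  have "bounded (flat p ` {0..c})"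
    by (intro compact_imp_bounded compact_continuous_image continuous_on_flat continuous_on_id) auto
  then obtain B where B: "B > 0" "\<And>t. t \<in> {0..c} \<Longrightarrow> \<bar>flat p t\<bar> \<le> B"
    unfolding bounded_pos by auto
  have "\<bar>flat p t\<bar> \<le> B" if "t \<le> c" for t
    using B that by (cases "t \<ge> 0") (auto simp: flat_def)
  with B(1) show ?thesis using that by blast
qed

text \<open>\<open>Ck\<close> recurses through all partial derivatives, so the induction runs over a
  whole set of functions at once; closure of \<open>S\<close> under coordinate derivatives is the
  induction step.\<close>

lemma Ck_of_real:
  fixes S :: "('a::euclidean_space \<Rightarrow> real) set"
  assumes cont: "\<And>f. f \<in> S \<Longrightarrow> continuous_on UNIV f"
    and deriv: "\<And>f b. f \<in> S \<Longrightarrow> b \<in> Basis \<Longrightarrow>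
      \<exists>f'\<in>S. \<forall>x. ((\<lambda>t. f (x + t *\<^sub>R b)) has_real_derivative f' x) (at 0)"
    and "f \<in> S"
  shows "Ck k (\<lambda>x. complex_of_real (f x))"
  using \<open>f \<in> S\<close>
proof (induction k arbitrary: f)
  case 0
  then show ?case by (auto intro!: continuous_intros cont)
next
  case (Suc k)
  have "(\<forall>x. (\<lambda>t. complex_of_real (f (x + t *\<^sub>R b))) differentiable (at 0)) \<and>
      Ck k (partial b (\<lambda>x. complex_of_real (f x)))" if "b \<in> Basis" for b
  proof -
    obtain f' where f': "f' \<in> S"
      "\<And>x. ((\<lambda>t. f (x + t *\<^sub>R b)) has_real_derivative f' x) (at 0)"
      using deriv[OF Suc.prems \<open>b \<in> Basis\<close>] by blast
    have vd: "((\<lambda>t. complex_of_real (f (x + t *\<^sub>R b))) has_vector_derivative complex_of_real (f' x)) (at 0)" for x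
      using f'(2)[of x] has_vector_derivative_of_real has_real_derivative_iff_has_vector_derivative by blast
    then have "partial b (\<lambda>x. complex_of_real (f x)) = (\<lambda>x. complex_of_real (f' x))"
      unfolding partial_def by (auto intro: vector_derivative_at)
    with Suc.IH[OF f'(1)] vd show ?thesis
      by (auto simp: has_vector_derivative_def differentiable_def)
  qed
  with Suc.prems show ?case by (auto intro!: continuous_intros cont)
qed

text \<open>The squared distance keeps the argument of \<open>flat\<close> polynomial in y, so the
  centre is not singular. The bump is not normalised; its mass is divided out only where
  approximation matters.\<close>

definition bump :: "real poly \<Rightarrow> 'a::euclidean_space \<Rightarrow> real \<Rightarrow> 'a \<Rightarrow> real" where
  "bump p x e y = flat p (e\<^sup>2 - (norm (y - x))\<^sup>2)"

text \<open>The chain rule for \<open>flat 1\<close> at e^2 - |w|^2 with w = y - x: this argument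
  has gradient -2w and Laplacian -2d in dimension d.\<close>

definition bump_laplacian :: "'a::euclidean_space \<Rightarrow> real \<Rightarrow> 'a \<Rightarrow> real" where
  "bump_laplacian x e y = 4 * (norm (y - x))\<^sup>2 * bump (flat_deriv (flat_deriv 1)) x e y
     - 2 * DIM('a) * bump (flat_deriv 1) x e y"

text \<open>Differentiating a bump along b produces another bump times a multiple of the coordinate
  of y - x along b. The algebra generated by bumps, constants and coordinates is thus closed under
  derivatives and serves as the set in \<open>Ck_of_real\<close>.\<close>

inductive_set bump_algebra :: "'a::euclidean_space \<Rightarrow> real \<Rightarrow> ('a \<Rightarrow> real) set"
  for x :: 'a and e :: real where
  bump_algebra_bump: "bump p x e \<in> bump_algebra x e"
| bump_algebra_const: "(\<lambda>_. c) \<in> bump_algebra x e"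
| bump_algebra_coord: "(\<lambda>y. (y - x) \<bullet> b) \<in> bump_algebra x e"
| bump_algebra_add: "f \<in> bump_algebra x e \<Longrightarrow> h \<in> bump_algebra x e \<Longrightarrow> (\<lambda>y. f y + h y) \<in> bump_algebra x e"
| bump_algebra_mult: "f \<in> bump_algebra x e \<Longrightarrow> h \<in> bump_algebra x e \<Longrightarrow> (\<lambda>y. f y * h y) \<in> bump_algebra x e"

section \<open>Derivatives of bumps along coordinate lines\<close>

lemma norm_add_scaleR_Basis:
  fixes w b :: "'a::euclidean_space"
  assumes "b \<in> Basis"
  shows "(norm (w + t *\<^sub>R b))\<^sup>2 = (norm w)\<^sup>2 + 2 * t * (w \<bullet> b) + t\<^sup>2"
proof -
  have "(norm (w + t *\<^sub>R b))\<^sup>2 = w \<bullet> w + 2 * t * (w \<bullet> b) + t * t"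
    unfolding power2_norm_eq_inner
    using assms by (simp add: inner_add_left inner_add_right inner_commute algebra_simps)
  then show ?thesis unfolding power2_norm_eq_inner by (simp add: power2_eq_square)
qed

lemma continuous_on_bump [continuous_intros]:
  "continuous_on S f \<Longrightarrow> continuous_on S h \<Longrightarrow> continuous_on S (\<lambda>y. bump p (h y) e (f y))"
  unfolding bump_def by (intro continuous_intros)

lemma bump_line_derivative:
  fixes x y b :: "'a::euclidean_space"
  assumes "b \<in> Basis"
  shows "((\<lambda>t. bump p x e (y + t *\<^sub>R b)) has_real_derivative
      bump (flat_deriv p) x e (y + t *\<^sub>R b) * (- 2 * ((y - x) \<bullet> b + t))) (at t)"
proof -
  have eq: "bump q x e (y + t *\<^sub>R b) = flat q (e\<^sup>2 - ((norm (y - x))\<^sup>2 + 2 * t * ((y - x) \<bullet> b) + t\<^sup>2))" for q t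
    unfolding bump_def norm_add_scaleR_Basis[OF assms, symmetric] by (simp add: algebra_simps)
  show ?thesis
    unfolding eq
    by (rule DERIV_chain2[OF flat_has_derivative])
       (auto intro!: derivative_eq_intros simp: algebra_simps)
qed

lemma bump_algebra_continuous: "f \<in> bump_algebra x e \<Longrightarrow> continuous_on UNIV f"
  by (induction rule: bump_algebra.induct) (auto intro!: continuous_intros)

lemma bump_algebra_derivative:
  assumes "f \<in> bump_algebra x e" and b: "b \<in> Basis"
  shows "\<exists>f'\<in>bump_algebra x e. \<forall>y. ((\<lambda>t. f (y + t *\<^sub>R b)) has_real_derivative f' y) (at 0)"
  using assms(1)
proof (induction rule: bump_algebra.induct)
  case (bump_algebra_bump p)
  have "(\<lambda>y. bump (flat_deriv p) x e y * (- 2 * ((y - x) \<bullet> b))) \<in> bump_algebra x e"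
    by (intro bump_algebra.intros)
  with bump_line_derivative[OF b, of p x e _ 0] show ?case by force
next
  case (bump_algebra_const c)
  show ?case by (intro bexI[of _ "\<lambda>_. 0"]) (auto intro!: bump_algebra.intros)
next
  case (bump_algebra_coord c)
  show ?case
    by (intro bexI[of _ "\<lambda>_. b \<bullet> c"])
       (auto intro!: bump_algebra.intros derivative_eq_intros simp: inner_add_left inner_diff_left)
next
  case (bump_algebra_add f h)
  then obtain f' h' where *: "f' \<in> bump_algebra x e" "h' \<in> bump_algebra x e"
    "\<And>y. ((\<lambda>t. f (y + t *\<^sub>R b)) has_real_derivative f' y) (at 0)"
    "\<And>y. ((\<lambda>t. h (y + t *\<^sub>R b)) has_real_derivative h' y) (at 0)" by blast
  then show ?case
    by (intro bexI[of _ "\<lambda>y. f' y + h' y"]) (auto intro!: bump_algebra.intros derivative_intros)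
next
  case (bump_algebra_mult f h)
  then obtain f' h' where *: "f' \<in> bump_algebra x e" "h' \<in> bump_algebra x e"
    "\<And>y. ((\<lambda>t. f (y + t *\<^sub>R b)) has_real_derivative f' y) (at 0)"
    "\<And>y. ((\<lambda>t. h (y + t *\<^sub>R b)) has_real_derivative h' y) (at 0)" by blast
  have "((\<lambda>t. f (y + t *\<^sub>R b) * h (y + t *\<^sub>R b)) has_real_derivative f' y * h y + h' y * f y) (at 0)" for y
    using DERIV_mult[OF *(3,4)[of y]] by simp
  with bump_algebra_mult *(1,2) show ?case
    by (intro bexI[of _ "\<lambda>y. f' y * h y + h' y * f y"]) (auto intro!: bump_algebra.intros)
qed

lemma bump_nonneg: "bump 1 x e y \<ge> 0"
  by (simp add: bump_def flat_def)

lemma bump_eq_0: "0 \<le> e \<Longrightarrow> norm (y - x) \<ge> e \<Longrightarrow> bump p x e y = 0"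
proof -
  assume "0 \<le> e" "norm (y - x) \<ge> e"
  then have "e\<^sup>2 \<le> (norm (y - x))\<^sup>2" by (intro power_mono)
  then show ?thesis by (simp add: bump_def flat_def)
qed

lemma bump_laplacian_eq_0: "0 \<le> e \<Longrightarrow> norm (y - x) \<ge> e \<Longrightarrow> bump_laplacian x e y = 0"
  by (simp add: bump_laplacian_def bump_eq_0)

lemma bump_pos: "0 \<le> e \<Longrightarrow> norm (y - x) < e \<Longrightarrow> bump 1 x e y > 0"
  by (simp add: bump_def flat_def power2_strict_mono)

lemma bump_commute: "bump p x e y = bump p y e x"
  by (simp add: bump_def norm_minus_commute)

lemma bump_test_function:
  assumes "e > 0"
  shows "(\<lambda>y. complex_of_real (bump p x e y)) \<in> test_functions"
proof -
  have "Ck k (\<lambda>y. complex_of_real (bump p x e y))" for k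
    by (rule Ck_of_real[where S="bump_algebra x e"])
       (auto intro: bump_algebra_continuous bump_algebra_derivative bump_algebra.intros)
  moreover have "{y. complex_of_real (bump p x e y) \<noteq> 0} \<subseteq> cball x e"
    using bump_eq_0[of e _ x p] assms by (force simp: dist_norm norm_minus_commute)
  then have "compact (closure {y. complex_of_real (bump p x e y) \<noteq> 0})"
    by (meson bounded_cball bounded_subset compact_closure)
  ultimately show ?thesis by (simp add: test_functions_def)
qed

lemma bump_line_derivative2:
  fixes x y b :: "'a::euclidean_space"
  assumes "b \<in> Basis"
  shows "((\<lambda>t. bump (flat_deriv p) x e (y + t *\<^sub>R b) * (- 2 * ((y - x) \<bullet> b + t))) has_real_derivative
      4 * ((y - x) \<bullet> b + t)\<^sup>2 * bump (flat_deriv (flat_deriv p)) x e (y + t *\<^sub>R b)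
        - 2 * bump (flat_deriv p) x e (y + t *\<^sub>R b)) (at t)"
  by (rule DERIV_cong[OF DERIV_mult[OF bump_line_derivative[OF assms]]])
     (auto intro!: derivative_eq_intros simp: power2_eq_square algebra_simps)

lemma sum_Basis_inner_squares: "(\<Sum>b\<in>Basis. (w \<bullet> b)\<^sup>2) = (norm (w::'a::euclidean_space))\<^sup>2"
  unfolding power2_norm_eq_inner by (simp add: euclidean_inner[of w w] power2_eq_square)

text \<open>Links the iterated complex \<open>partial\<close> of the weak formulation to the
  explicit real formula used in all later estimates.\<close>

lemma laplacian_bump:
  "laplacian (\<lambda>y. complex_of_real (bump 1 x e y)) y = of_real (bump_laplacian x e y)"
proof -
  have 1: "partial b (\<lambda>y. complex_of_real (bump 1 x e y))
      = (\<lambda>y. complex_of_real (bump (flat_deriv 1) x e y * (- 2 * ((y - x) \<bullet> b))))"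
    if "b \<in> Basis" for b
  proof
    fix y
    from has_vector_derivative_of_real[OF bump_line_derivative[OF that, of 1 x e y 0]]
    show "partial b (\<lambda>y. complex_of_real (bump 1 x e y)) y
      = complex_of_real (bump (flat_deriv 1) x e y * (- 2 * ((y - x) \<bullet> b)))"
      unfolding partial_def by (intro vector_derivative_at) simp
  qed
  have shift: "(y + t *\<^sub>R b - x) \<bullet> b = (y - x) \<bullet> b + t" if "b \<in> Basis" for b t
    using that by (simp add: inner_add_left inner_diff_left)
  have 2: "partial b (partial b (\<lambda>y. complex_of_real (bump 1 x e y))) y
      = of_real (4 * ((y - x) \<bullet> b)\<^sup>2 * bump (flat_deriv (flat_deriv 1)) x e y - 2 * bump (flat_deriv 1) x e y)"
    if "b \<in> Basis" for b
  proof -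
    have "((\<lambda>t. complex_of_real (bump (flat_deriv 1) x e (y + t *\<^sub>R b) * (- 2 * ((y + t *\<^sub>R b - x) \<bullet> b))))
        has_vector_derivative complex_of_real (4 * ((y - x) \<bullet> b)\<^sup>2 * bump (flat_deriv (flat_deriv 1)) x e y
           - 2 * bump (flat_deriv 1) x e y)) (at 0)"
      using has_vector_derivative_of_real[OF bump_line_derivative2[OF that, of 1 x e y 0]]
      unfolding shift[OF that] by simp
    then show ?thesis
      unfolding 1[OF that] unfolding partial_def by (rule vector_derivative_at)
  qed
  show ?thesis
    unfolding laplacian_def bump_laplacian_def
    by (simp add: 2 sum_subtractf flip: of_real_sum of_real_mult of_real_diff sum_distrib_left sum_distrib_right
        sum_Basis_inner_squares)
qed

section \<open>Pointwise Laplacians\<close>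

definition second_difference :: "('a::euclidean_space \<Rightarrow> real) \<Rightarrow> 'a \<Rightarrow> real \<Rightarrow> 'a \<Rightarrow> real" where
  "second_difference v z t b = (v (z + t *\<^sub>R b) + v (z - t *\<^sub>R b) - 2 * v z) / t\<^sup>2"

text \<open>Symmetric second differences have a sign at a local maximum and pass through integrals
  without differentiation under the integral sign. The limit ignores t = 0, where the quotient is 0
  by convention.\<close>

definition has_laplacian :: "('a::euclidean_space \<Rightarrow> real) \<Rightarrow> 'a \<Rightarrow> real \<Rightarrow> bool" where
  "has_laplacian v z L \<longleftrightarrow> ((\<lambda>t. \<Sum>b\<in>Basis. second_difference v z t b) \<longlongrightarrow> L) (at 0)"

lemma has_laplacian_diff:
  assumes "has_laplacian v z L" "has_laplacian w z K"
  shows "has_laplacian (\<lambda>x. v x - w x) z (L - K)"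
proof -
  have *: "second_difference (\<lambda>x. v x - w x) z t b = second_difference v z t b - second_difference w z t b" for t b
    by (simp add: second_difference_def algebra_simps flip: diff_divide_distrib)
  show ?thesis
    using tendsto_diff[OF assms[unfolded has_laplacian_def]]
    by (simp add: has_laplacian_def * sum_subtractf)
qed

lemma has_laplacian_cmult:
  assumes "has_laplacian v z L"
  shows "has_laplacian (\<lambda>x. c * v x) z (c * L)"
proof -
  have *: "second_difference (\<lambda>x. c * v x) z t b = c * second_difference v z t b" for t b
    by (simp add: second_difference_def algebra_simps)
  show ?thesis
    using tendsto_mult_left[OF assms[unfolded has_laplacian_def], of c]
    by (simp add: has_laplacian_def * sum_distrib_left)
qed

lemma has_laplacian_local_max:
  fixes w :: "'a::euclidean_space \<Rightarrow> real"
  assumes "d > 0" and max: "\<And>y. dist z y < d \<Longrightarrow> w y \<le> w z" and "has_laplacian w z L"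
  shows "L \<le> 0"
proof -
  have "\<forall>\<^sub>F t in at (0::real). \<bar>t\<bar> < d"
    using \<open>d > 0\<close> by (auto simp: eventually_at dist_real_def)
  then have "\<forall>\<^sub>F t in at (0::real). (\<Sum>b\<in>Basis. second_difference w z t b) \<le> 0"
  proof eventually_elim
    case (elim t)
    have "second_difference w z t b \<le> 0" if "b \<in> Basis" for b
    proof -
      have "w (z + t *\<^sub>R b) \<le> w z" "w (z - t *\<^sub>R b) \<le> w z"
        using elim that by (auto intro!: max simp: dist_norm)
      then show ?thesis by (simp add: second_difference_def divide_nonpos_nonneg)
    qed
    then show ?case by (rule sum_nonpos)
  qed
  with assms(3)[unfolded has_laplacian_def] show ?thesis
    by (rule tendsto_upperbound) simp
qed

text \<open>One use of l'Hopital leaves (f'(t) - f'(-t)) / (2t), the mean of two difference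
  quotients of f' at 0, both of which tend to l.\<close>

lemma second_difference_tendsto:
  fixes f f' :: "real \<Rightarrow> real"
  assumes "d > 0" and f: "\<And>t. \<bar>t\<bar> < d \<Longrightarrow> (f has_real_derivative f' t) (at t)"
    and f': "(f' has_real_derivative l) (at 0)"
  shows "((\<lambda>t. (f t + f (- t) - 2 * f 0) / t\<^sup>2) \<longlongrightarrow> l) (at 0)"
proof (rule lhopital)
  have cont: "isCont f 0" using f[of 0] \<open>d > 0\<close> by (auto intro: DERIV_isCont)
  have lim: "(f \<longlongrightarrow> f 0) (at 0)" using cont by (simp add: isCont_def)
  have "filterlim uminus (at 0) (at (0::real))"
    by (auto intro!: filterlim_atI tendsto_eq_intros simp: eventually_at_filter)
  from filterlim_compose[OF lim this]
  have "((\<lambda>t. f (- t)) \<longlongrightarrow> f 0) (at 0)" .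
  with lim have "((\<lambda>t. f t + f (- t) - 2 * f 0) \<longlongrightarrow> f 0 + f 0 - 2 * f 0) (at 0)"
    by (intro tendsto_intros)
  then show "((\<lambda>t. f t + f (- t) - 2 * f 0) \<longlongrightarrow> 0) (at 0)" by simp
  show "((\<lambda>t::real. t\<^sup>2) \<longlongrightarrow> 0) (at 0)" by (auto intro!: tendsto_eq_intros)
  show "\<forall>\<^sub>F t in at (0::real). t\<^sup>2 \<noteq> 0" by (auto simp: eventually_at_filter)
  show "\<forall>\<^sub>F t in at (0::real). 2 * t \<noteq> 0" by (auto simp: eventually_at_filter)
  show "\<forall>\<^sub>F t in at (0::real). ((\<lambda>t::real. t\<^sup>2) has_real_derivative 2 * t) (at t)"
    by (auto intro!: always_eventually derivative_eq_intros)
  have small: "\<forall>\<^sub>F t in at (0::real). \<bar>t\<bar> < d"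
    using \<open>d > 0\<close> by (auto simp: eventually_at dist_real_def)
  show "\<forall>\<^sub>F t in at 0. ((\<lambda>t. f t + f (- t) - 2 * f 0) has_real_derivative f' t - f' (- t)) (at t)"
    using small
  proof eventually_elim
    case (elim t)
    have "((\<lambda>t. f (- t)) has_real_derivative f' (- t) * (- 1)) (at t)"
      using elim by (intro DERIV_chain2[OF f]) (auto intro!: derivative_eq_intros)
    then show ?case using f[OF elim] by (auto intro!: derivative_eq_intros)
  qed
  have q: "((\<lambda>t. (f' t - f' 0) / t) \<longlongrightarrow> l) (at 0)"
    using f' by (simp add: has_field_derivative_iff)
  have "filterlim uminus (at 0) (at (0::real))"
    by (auto intro!: filterlim_atI tendsto_eq_intros simp: eventually_at_filter)
  from filterlim_compose[OF q this]
  have "((\<lambda>t. (f' (- t) - f' 0) / - t) \<longlongrightarrow> l) (at 0)" .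
  with q have "((\<lambda>t. ((f' t - f' 0) / t + (f' (- t) - f' 0) / - t) / 2) \<longlongrightarrow> (l + l) / 2) (at 0)"
    by (intro tendsto_intros) auto
  moreover have quot: "((f' t - f' 0) / t + (f' (- t) - f' 0) / - t) / 2 = (f' t - f' (- t)) / (2 * t)" for t
    by (cases "t = 0") (auto simp: field_simps)
  ultimately show "((\<lambda>t. (f' t - f' (- t)) / (2 * t)) \<longlongrightarrow> l) (at 0)"
    unfolding quot by simp
qed

lemma has_laplacian_lines:
  fixes v :: "'a::euclidean_space \<Rightarrow> real"
  assumes "d > 0"
    and "\<And>b t. b \<in> Basis \<Longrightarrow> \<bar>t\<bar> < d \<Longrightarrow> ((\<lambda>t. v (z + t *\<^sub>R b)) has_real_derivative f' b t) (at t)"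
    and "\<And>b. b \<in> Basis \<Longrightarrow> (f' b has_real_derivative l b) (at 0)"
  shows "has_laplacian v z (\<Sum>b\<in>Basis. l b)"
  unfolding has_laplacian_def
proof (rule tendsto_sum)
  fix b :: 'a assume b: "b \<in> Basis"
  show "((\<lambda>t. second_difference v z t b) \<longlongrightarrow> l b) (at 0)"
    using second_difference_tendsto[OF \<open>d > 0\<close> assms(2)[OF b] assms(3)[OF b]]
    by (simp add: second_difference_def)
qed

text \<open>Along a coordinate line the squared radius is a quadratic polynomial, so the second
  derivative at 0 is 4 (w . b)^2 G2 + 2 G' with w = z - a; summing over the basis gives the formula.
  With |y - a| as the variable, the centre would be a special case.\<close>

lemma has_laplacian_radial:
  fixes a z :: "'a::euclidean_space" and G G' :: "real \<Rightarrow> real"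
  assumes "open S" "(norm (z - a))\<^sup>2 \<in> S"
    and G: "\<And>s. s \<in> S \<Longrightarrow> (G has_real_derivative G' s) (at s)"
    and G': "(G' has_real_derivative G2) (at ((norm (z - a))\<^sup>2))"
  shows "has_laplacian (\<lambda>y. G ((norm (y - a))\<^sup>2)) z
    (4 * (norm (z - a))\<^sup>2 * G2 + 2 * DIM('a) * G' ((norm (z - a))\<^sup>2))"
proof -
  define w where "w = z - a"
  define q where "q b t = (norm w)\<^sup>2 + 2 * t * (w \<bullet> b) + t\<^sup>2" for b t
  have "isCont (\<lambda>t. q b t) 0" for b
    unfolding q_def by (intro continuous_intros)
  then have "\<forall>\<^sub>F t in at 0. q b t \<in> S" for b
    using assms(1,2) unfolding isCont_def q_def w_def
    by (intro topological_tendstoD) auto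
  then have "\<forall>\<^sub>F t in at 0. \<forall>b\<in>Basis. q b t \<in> S"
    by (intro eventually_ball_finite) auto
  then obtain d where d: "d > 0" "\<And>t b. t \<noteq> 0 \<Longrightarrow> \<bar>t\<bar> < d \<Longrightarrow> b \<in> Basis \<Longrightarrow> q b t \<in> S"
    unfolding eventually_at by (auto simp: dist_real_def)
  have S: "q b t \<in> S" if "\<bar>t\<bar> < d" "b \<in> Basis" for b t
    using d(2)[of t b] that assms(2) by (cases "t = 0") (auto simp: q_def w_def)
  have eq: "G ((norm (z + t *\<^sub>R b - a))\<^sup>2) = G (q b t)" if "b \<in> Basis" for b t
    unfolding q_def norm_add_scaleR_Basis[OF that, symmetric] w_def by (simp add: algebra_simps)
  have dq: "(q b has_real_derivative 2 * (w \<bullet> b + t)) (at t)" for b t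
    unfolding q_def by (auto intro!: derivative_eq_intros)
  have q0: "q b 0 = (norm (z - a))\<^sup>2" for b by (simp add: q_def w_def)
  have "has_laplacian (\<lambda>y. G ((norm (y - a))\<^sup>2)) z
     (\<Sum>b\<in>Basis. G2 * (4 * (w \<bullet> b)\<^sup>2) + 2 * G' ((norm (z - a))\<^sup>2))"
  proof (rule has_laplacian_lines[OF d(1)])
    fix b :: 'a and t :: real assume b: "b \<in> Basis" and t: "\<bar>t\<bar> < d"
    show "((\<lambda>t. G ((norm (z + t *\<^sub>R b - a))\<^sup>2)) has_real_derivative G' (q b t) * (2 * (w \<bullet> b + t))) (at t)"
      unfolding eq[OF b] by (rule DERIV_chain2[OF G[OF S[OF t b]] dq])
  next
    fix b :: 'a assume b: "b \<in> Basis"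
    have "((\<lambda>t. G' (q b t)) has_real_derivative G2 * (2 * (w \<bullet> b + 0))) (at 0)"
      using G' by (intro DERIV_chain2[OF _ dq]) (simp add: q0)
    then show "((\<lambda>t. G' (q b t) * (2 * (w \<bullet> b + t))) has_real_derivative
        G2 * (4 * (w \<bullet> b)\<^sup>2) + 2 * G' ((norm (z - a))\<^sup>2)) (at 0)"
      by (rule DERIV_cong[OF DERIV_mult])
         (auto intro!: derivative_eq_intros simp: q0 power2_eq_square)
  qed
  also have "(\<Sum>b\<in>Basis. G2 * (4 * (w \<bullet> b)\<^sup>2) + 2 * G' ((norm (z - a))\<^sup>2))
      = 4 * (norm (z - a))\<^sup>2 * G2 + 2 * DIM('a) * G' ((norm (z - a))\<^sup>2)"
    by (simp add: sum.distrib sum_Basis_inner_squares w_def flip: sum_distrib_left)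
  finally show ?thesis .
qed

section \<open>Mollification and the comparison principle\<close>

definition mollify :: "('a::euclidean_space \<Rightarrow> real) \<Rightarrow> real \<Rightarrow> 'a \<Rightarrow> real" where
  "mollify u e x = (LINT y|lborel. u y * bump 1 x e y)"

lemma integrable_compact_support:
  fixes f :: "'a::euclidean_space \<Rightarrow> real"
  assumes "continuous_on UNIV f" and "\<And>y. norm (y - x) > r \<Longrightarrow> f y = 0"
  shows "integrable lborel f"
proof -
  have "integrable lborel (\<lambda>y. indicator (cball x r) y *\<^sub>R f y)"
    by (intro borel_integrable_compact continuous_on_subset[OF assms(1)]) auto
  also have "(\<lambda>y. indicator (cball x r) y *\<^sub>R f y) = f"
    using assms(2) by (auto simp: indicator_def dist_norm norm_minus_commute not_le fun_eq_iff)
  finally show ?thesis .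
qed

lemma continuous_bump: "continuous_on UNIV (bump p x e)"
  by (intro continuous_intros)

lemma continuous_bump_laplacian: "continuous_on UNIV (bump_laplacian x e)"
  unfolding bump_laplacian_def by (intro continuous_intros)

lemma integrable_times_bump:
  assumes "continuous_on UNIV u" "e > 0"
  shows "integrable lborel (\<lambda>y. u y * bump p x e y)"
  using assms
  by (intro integrable_compact_support[where x=x and r=e] continuous_intros continuous_bump) (auto simp: bump_eq_0)

lemma integrable_times_bump_laplacian:
  assumes "continuous_on UNIV u" "e > 0"
  shows "integrable lborel (\<lambda>y. u y * bump_laplacian x e y)"
  using assms
  by (intro integrable_compact_support[where x=x and r=e] continuous_intros continuous_bump_laplacian)
     (auto simp: bump_laplacian_eq_0)

text \<open>Dominated convergence with B |u| on the closed ball as dominating function. The first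
  \<open>N\<close> terms are dropped because the common support is guaranteed only
  afterwards.\<close>

lemma integral_tendsto_compact_support:
  fixes u :: "'a::euclidean_space \<Rightarrow> real"
  assumes u: "continuous_on UNIV u"
    and h: "\<And>n. continuous_on UNIV (h n)" "continuous_on UNIV k"
    and lim: "\<And>y. (\<lambda>n. h n y) \<longlonglongrightarrow> k y"
    and bound: "\<And>n y. \<bar>h n y\<bar> \<le> B"
    and supp: "\<And>n y. n \<ge> N \<Longrightarrow> norm (y - x) > r \<Longrightarrow> h n y = 0"
  shows "(\<lambda>n. LINT y|lborel. u y * h n y) \<longlonglongrightarrow> (LINT y|lborel. u y * k y)"
proof (rule LIMSEQ_offset[where k=N], rule integral_dominated_convergence)
  have "continuous_on UNIV (\<lambda>y. u y * k y)" "continuous_on UNIV (\<lambda>y. u y * h n y)" for n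
    using u h by (auto intro!: continuous_intros)
  then show "(\<lambda>y. u y * k y) \<in> borel_measurable lborel" "(\<lambda>y. u y * h (n + N) y) \<in> borel_measurable lborel" for n
    by (auto intro: borel_measurable_continuous_onI)
  show "integrable lborel (\<lambda>y. indicator (cball x r) y *\<^sub>R (B * \<bar>u y\<bar>))"
    by (intro borel_integrable_compact continuous_intros continuous_on_subset[OF u]) auto
  show "AE y in lborel. (\<lambda>n. u y * h (n + N) y) \<longlonglongrightarrow> u y * k y"
    using lim by (intro AE_I2 tendsto_intros LIMSEQ_ignore_initial_segment)
  show "AE y in lborel. norm (u y * h (n + N) y) \<le> indicator (cball x r) y *\<^sub>R (B * \<bar>u y\<bar>)" for n
  proof (rule AE_I2)
    fix y
    show "norm (u y * h (n + N) y) \<le> indicator (cball x r) y *\<^sub>R (B * \<bar>u y\<bar>)"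
    proof (cases "norm (y - x) > r")
      case True
      then show ?thesis using supp[of "n + N" y]
        by (simp add: dist_norm norm_minus_commute)
    next
      case False
      then show ?thesis using mult_left_mono[OF bound[of "n + N" y], of "\<bar>u y\<bar>"]
        by (simp add: dist_norm norm_minus_commute abs_mult mult.commute)
    qed
  qed
qed

lemma bump_bounded:
  obtains B where "B > 0" "\<And>x y. \<bar>bump p x e y\<bar> \<le> B"
proof -
  obtain B where "B > 0" "\<And>t. t \<le> e\<^sup>2 \<Longrightarrow> \<bar>flat p t\<bar> \<le> B"
    using flat_bounded_atMost by blast
  then show ?thesis using that[of B] by (simp add: bump_def)
qed

lemma continuous_mollify:
  fixes u :: "'a::euclidean_space \<Rightarrow> real"
  assumes u: "continuous_on UNIV u" and "e > 0"
  shows "continuous_on UNIV (mollify u e)"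
  unfolding continuous_on_sequentially comp_def
proof (intro allI ballI impI, elim conjE)
  fix X and x :: 'a assume X: "X \<longlonglongrightarrow> x"
  obtain N where N: "\<And>n. n \<ge> N \<Longrightarrow> dist (X n) x < 1"
    using X unfolding lim_sequentially by (meson zero_less_one)
  obtain B where B: "\<And>x y::'a. \<bar>bump 1 x e y\<bar> \<le> B" using bump_bounded by blast
  show "(\<lambda>n. mollify u e (X n)) \<longlonglongrightarrow> mollify u e x"
    unfolding mollify_def
  proof (rule integral_tendsto_compact_support[OF u continuous_bump continuous_bump _ B, where N=N and x=x and r="e + 1"])
    have "isCont (\<lambda>x. bump 1 x e y) x" for y :: 'a
      using continuous_on_bump[of UNIV "\<lambda>_. y" "\<lambda>x. x" 1 e]
      by (simp add: continuous_on_eq_continuous_at)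
    then show "(\<lambda>n. bump 1 (X n) e y) \<longlonglongrightarrow> bump 1 x e y" for y
      using X by (rule isCont_tendsto_compose)
    fix n y assume "n \<ge> N" "norm (y - x) > e + 1"
    moreover have "norm (y - x) \<le> norm (y - X n) + dist (X n) x"
      by (metis dist_norm dist_triangle)
    ultimately show "bump 1 (X n) e y = 0"
      using N[of n] \<open>e > 0\<close> by (intro bump_eq_0) auto
  qed
qed

text \<open>Supplies domination uniform in t. The mean value inequality makes f' Lipschitz with
  constant B, so the derivative of f(s) + f(-s) is at most 2 B |t| for |s| \<le> |t|; a second
  application gives 2 B t^2.\<close>

lemma second_difference_le:
  fixes f f' :: "real \<Rightarrow> real"
  assumes f: "\<And>t. (f has_real_derivative f' t) (at t)"
    and f': "\<And>t. (f' has_real_derivative f'' t) (at t)"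
    and bound: "\<And>t. \<bar>f'' t\<bar> \<le> B"
  shows "\<bar>(f t + f (- t) - 2 * f 0) / t\<^sup>2\<bar> \<le> 2 * B"
proof (cases "t = 0")
  case True
  \<comment> \<open>The quotient is 0 by division by zero, and \<open>bound[of 0]\<close> yields B
    \<ge> 0.\<close>
  then show ?thesis using bound[of 0] by simp
next
  case False
  have lip: "\<bar>f' s - f' r\<bar> \<le> B * \<bar>s - r\<bar>" for s r
    using field_differentiable_bound[of UNIV f' f'' B s r] f' bound by simp
  define h where "h s = f s + f (- s)" for s
  have dh: "(h has_real_derivative f' s - f' (- s)) (at s)" for s
  proof -
    have "((\<lambda>s. f (- s)) has_real_derivative f' (- s) * (- 1)) (at s)"
      by (intro DERIV_chain2[OF f]) (auto intro!: derivative_eq_intros)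
    then show ?thesis unfolding h_def using f by (auto intro!: derivative_eq_intros)
  qed
  have "\<bar>h t - h 0\<bar> \<le> (2 * B * \<bar>t\<bar>) * \<bar>t - 0\<bar>"
    unfolding real_norm_def[symmetric]
  proof (rule field_differentiable_bound[of "{- \<bar>t\<bar>..\<bar>t\<bar>}" h "\<lambda>s. f' s - f' (- s)"])
    fix s assume s: "s \<in> {- \<bar>t\<bar>..\<bar>t\<bar>}"
    show "(h has_real_derivative f' s - f' (- s)) (at s within {- \<bar>t\<bar>..\<bar>t\<bar>})"
      using dh by (rule has_field_derivative_at_within)
    have "\<bar>f' s - f' (- s)\<bar> \<le> B * \<bar>s - - s\<bar>" by (rule lip)
    also have "\<dots> \<le> B * (2 * \<bar>t\<bar>)"
      using s bound[of 0] by (intro mult_left_mono) auto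
    finally show "norm (f' s - f' (- s)) \<le> 2 * B * norm t" by simp
  qed auto
  then have "\<bar>f t + f (- t) - 2 * f 0\<bar> \<le> 2 * B * t\<^sup>2"
    by (simp add: h_def power2_eq_square mult.assoc)
  with False show ?thesis by (simp add: divide_le_eq)
qed

text \<open>The second derivative along a line contains an unbounded coordinate factor, but this is
  at most |e| wherever the bump multiplying it is nonzero. The absolute value appears because bumps
  see only e^2 and the sign of e is free.\<close>

lemma second_difference_bump_bounded:
  "\<exists>B. \<forall>x z t. \<forall>b\<in>Basis. \<bar>second_difference (bump 1 x e) (z::'a::euclidean_space) t b\<bar> \<le> B"
proof -
  obtain B1 where B1: "B1 > 0" "\<And>x y::'a. \<bar>bump (flat_deriv 1) x e y\<bar> \<le> B1" using bump_bounded by blast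
  obtain B2 where B2: "B2 > 0" "\<And>x y::'a. \<bar>bump (flat_deriv (flat_deriv 1)) x e y\<bar> \<le> B2" using bump_bounded by blast
  have "\<bar>second_difference (bump 1 x e) z t b\<bar> \<le> 2 * (4 * (\<bar>e\<bar>\<^sup>2 * B2) + 2 * B1)"
    if b: "b \<in> Basis" for x z b :: 'a and t
  proof -
    define d2 where "d2 t = 4 * ((z - x) \<bullet> b + t)\<^sup>2 * bump (flat_deriv (flat_deriv 1)) x e (z + t *\<^sub>R b)
        - 2 * bump (flat_deriv 1) x e (z + t *\<^sub>R b)" for t
    have "\<bar>d2 t\<bar> \<le> 4 * (\<bar>e\<bar>\<^sup>2 * B2) + 2 * B1" for t
    proof -
      have "\<bar>((z - x) \<bullet> b + t)\<^sup>2 * bump (flat_deriv (flat_deriv 1)) x e (z + t *\<^sub>R b)\<bar> \<le> \<bar>e\<bar>\<^sup>2 * B2"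
      proof (cases "norm (z + t *\<^sub>R b - x) \<ge> \<bar>e\<bar>")
        case True
        then have "bump (flat_deriv (flat_deriv 1)) x \<bar>e\<bar> (z + t *\<^sub>R b) = 0"
          by (intro bump_eq_0) auto
        then show ?thesis using B2 by (simp add: bump_def)
      next
        case False
        have "(z - x) \<bullet> b + t = (z + t *\<^sub>R b - x) \<bullet> b"
          using b by (simp add: inner_add_left inner_diff_left)
        then have "\<bar>(z - x) \<bullet> b + t\<bar> \<le> \<bar>e\<bar>"
          using Basis_le_norm[OF b, of "z + t *\<^sub>R b - x"] False by simp
        then have "((z - x) \<bullet> b + t)\<^sup>2 \<le> \<bar>e\<bar>\<^sup>2" by (simp add: abs_le_square_iff)
        then show ?thesis using B2 by (simp add: abs_mult mult_mono del: power2_abs)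
      qed
      moreover have "\<bar>bump (flat_deriv 1) x e (z + t *\<^sub>R b)\<bar> \<le> B1" by (rule B1)
      ultimately show ?thesis unfolding d2_def mult.assoc by linarith
    qed
    from second_difference_le[OF bump_line_derivative[OF b, of 1 x e z]
        bump_line_derivative2[OF b, of 1 x e z] this[unfolded d2_def], of t]
    show ?thesis by (simp add: second_difference_def)
  qed
  then show ?thesis by blast
qed

lemma has_laplacian_bump:
  fixes x z :: "'a::euclidean_space"
  shows "has_laplacian (bump 1 x e) z (bump_laplacian x e z)"
proof -
  have d: "((\<lambda>s. flat p (e\<^sup>2 - s)) has_real_derivative flat (flat_deriv p) (e\<^sup>2 - s) * (- 1)) (at s)" for p s
    by (rule DERIV_chain2[OF flat_has_derivative]) (auto intro!: derivative_eq_intros)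
  have "has_laplacian (\<lambda>y. flat 1 (e\<^sup>2 - (norm (y - x))\<^sup>2)) z
    (4 * (norm (z - x))\<^sup>2 * flat (flat_deriv (flat_deriv 1)) (e\<^sup>2 - (norm (z - x))\<^sup>2)
     + 2 * DIM('a) * - flat (flat_deriv 1) (e\<^sup>2 - (norm (z - x))\<^sup>2))"
    by (rule has_laplacian_radial[where S=UNIV and G="\<lambda>s. flat 1 (e\<^sup>2 - s)" and G'="\<lambda>s. - flat (flat_deriv 1) (e\<^sup>2 - s)"])
       (use d[of 1] DERIV_minus[OF d[of "flat_deriv 1"]] in \<open>simp_all only: open_UNIV UNIV_I mult_minus1_right minus_minus\<close>)
  then show ?thesis by (simp add: bump_laplacian_def bump_def[abs_def])
qed

text \<open>Second differences in z fall on the kernel. As the bump is symmetric in centre and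
  argument, they become second differences of bumps centred at y, which are uniformly bounded;
  dominated convergence along sequences of step lengths finishes.\<close>

lemma has_laplacian_mollify:
  fixes u :: "'a::euclidean_space \<Rightarrow> real"
  assumes u: "continuous_on UNIV u" and "e > 0"
  shows "has_laplacian (mollify u e) z (LINT y|lborel. u y * bump_laplacian z e y)"
  unfolding has_laplacian_def tendsto_at_iff_sequentially comp_def
proof (intro allI impI)
  fix X :: "nat \<Rightarrow> real" assume X: "\<forall>i. X i \<in> UNIV - {0}" "X \<longlonglongrightarrow> 0"
  define h where "h n y = (\<Sum>b\<in>Basis. second_difference (bump 1 y e) z (X n) b)" for n y
  have eq: "(\<Sum>b\<in>Basis. second_difference (mollify u e) z (X n) b) = (LINT y|lborel. u y * h n y)" for n
  proof -
    have *: "has_bochner_integral lborel (\<lambda>y. u y * second_difference (bump 1 y e) z t b)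
        (second_difference (mollify u e) z t b)" for t b
    proof -
      have int: "has_bochner_integral lborel (\<lambda>y. u y * bump 1 x e y) (mollify u e x)" for x
        using integrable_times_bump[OF u \<open>e > 0\<close>, of 1] by (simp add: has_bochner_integral_iff mollify_def)
      have "u y * second_difference (bump 1 y e) z t b =
        (u y * bump 1 (z + t *\<^sub>R b) e y + u y * bump 1 (z - t *\<^sub>R b) e y - 2 * (u y * bump 1 z e y)) / t\<^sup>2" for y
        unfolding second_difference_def bump_commute[of 1 _ e z] bump_commute[of 1 _ e "z + t *\<^sub>R b"]
            bump_commute[of 1 _ e "z - t *\<^sub>R b"] by (simp add: algebra_simps)
      then show ?thesis
        unfolding second_difference_def[of "mollify u e"]
        by (simp only:) (intro has_bochner_integral_divide_zero has_bochner_integral_diff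
              has_bochner_integral_add has_bochner_integral_mult_right int)
    qed
    then have "has_bochner_integral lborel (\<lambda>y. \<Sum>b\<in>Basis. u y * second_difference (bump 1 y e) z (X n) b)
        (\<Sum>b\<in>Basis. second_difference (mollify u e) z (X n) b)"
      by (intro has_bochner_integral_sum)
    then show ?thesis
      by (simp add: h_def sum_distrib_left has_bochner_integral_iff)
  qed
  \<comment> \<open>Once the steps are shorter than 1, every y with |y - z| > e + 1 is at distance
    at least e from all points of the difference; hence the common support radius e + 1.\<close>
  obtain N where N: "\<And>n. n \<ge> N \<Longrightarrow> \<bar>X n\<bar> < 1"
    using X(2) unfolding LIMSEQ_iff by (metis diff_0_right real_norm_def zero_less_one)
  obtain B where B: "\<forall>x z t. \<forall>b\<in>Basis. \<bar>second_difference (bump 1 x e) (z::'a) t b\<bar> \<le> B"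
    using second_difference_bump_bounded ..
  show "(\<lambda>n. \<Sum>b\<in>Basis. second_difference (mollify u e) z (X n) b) \<longlonglongrightarrow> (LINT y|lborel. u y * bump_laplacian z e y)"
    unfolding eq
  proof (rule integral_tendsto_compact_support[OF u _ continuous_bump_laplacian, where N=N and x=z and r="e + 1" and B="DIM('a) * B"])
    show "continuous_on UNIV (h n)" for n
      unfolding h_def second_difference_def by (intro continuous_intros) (use X(1) in auto)
    have "bump_laplacian y e z = bump_laplacian z e y" for y
      unfolding bump_laplacian_def bump_commute[of _ y] norm_minus_commute[of z] by (rule refl)
    then show "(\<lambda>n. h n y) \<longlonglongrightarrow> bump_laplacian z e y" for y
      using has_laplacian_bump[of y e z] X
      unfolding has_laplacian_def tendsto_at_iff_sequentially comp_def h_def by simp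
    show "\<bar>h n y\<bar> \<le> DIM('a) * B" for n y
    proof -
      have "\<bar>h n y\<bar> \<le> (\<Sum>b\<in>Basis. \<bar>second_difference (bump 1 y e) z (X n) b\<bar>)"
        unfolding h_def by (rule sum_abs)
      also have "\<dots> \<le> (\<Sum>b\<in>(Basis :: 'a set). B)" using B by (intro sum_mono) blast
      finally show ?thesis by simp
    qed
    fix n y assume n: "n \<ge> N" and y: "norm (y - z) > e + 1"
    have "second_difference (bump 1 y e) z (X n) b = 0" if "b \<in> Basis" for b
    proof -
      have "norm (z - y) \<le> norm (z + X n *\<^sub>R b - y) + \<bar>X n\<bar>" "norm (z - y) \<le> norm (z - X n *\<^sub>R b - y) + \<bar>X n\<bar>"
        using norm_triangle_ineq4[of "z + X n *\<^sub>R b - y" "X n *\<^sub>R b"]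
          norm_triangle_ineq[of "z - X n *\<^sub>R b - y" "X n *\<^sub>R b"] that by auto
      then have "norm (z + X n *\<^sub>R b - y) \<ge> e" "norm (z - X n *\<^sub>R b - y) \<ge> e" "norm (z - y) \<ge> e"
        using y N[OF n] by (auto simp: norm_minus_commute)
      then show ?thesis using \<open>e > 0\<close> by (simp add: second_difference_def bump_eq_0)
    qed
    then show "h n y = 0" by (simp add: h_def)
  qed
qed

section \<open>Mass of the bumps and approximation by normalised mollification\<close>

lemma integral_bump_translate:
  fixes x :: "'a::euclidean_space"
  shows "(LINT y|lborel. bump p x e y) = (LINT y|lborel. bump p 0 e (y::'a))"
proof -
  have "(LINT y|lborel. bump p x e y) = (LINT y|distr lborel borel ((+) x). bump p x e y)"
    by (simp add: lborel_distr_plus)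
  also have "\<dots> = (LINT y|lborel. bump p x e (x + y))"
    by (intro integral_distr borel_measurable_continuous_onI continuous_bump) auto
  finally show ?thesis by (simp add: bump_def)
qed

lemma integrable_bump: "e > 0 \<Longrightarrow> integrable lborel (bump p x e)"
  using integrable_times_bump[of "\<lambda>_. 1" e p x] by simp

lemma integral_bump_pos:
  assumes "e > 0"
  shows "(LINT y|lborel. bump 1 (x::'a::euclidean_space) e y) > 0"
proof -
  have "(LINT y|lborel. bump 1 x e y) \<noteq> 0"
  proof
    assume "(LINT y|lborel. bump 1 x e y) = 0"
    then have "AE y in lborel. bump 1 x e y = 0"
      using integral_nonneg_eq_0_iff_AE[OF integrable_bump[OF assms, of 1 x]] bump_nonneg by auto
    then have "emeasure lborel {y. bump 1 x e y \<noteq> 0} = 0"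
      using continuous_bump[of 1 x e] by (subst (asm) AE_iff_measurable) (auto intro!: borel_open open_Collect_neq continuous_intros)
    moreover have "emeasure lborel (ball x e) \<le> emeasure lborel {y. bump 1 x e y \<noteq> 0}"
      using bump_pos[of e _ x] assms continuous_bump[of 1 x e]
      by (intro emeasure_mono) (force simp: dist_norm norm_minus_commute, auto intro!: borel_open open_Collect_neq continuous_intros)
    moreover have "emeasure lborel (ball x e) > 0"
      using content_ball_pos[OF assms, of x] by (auto simp: measure_def zero_less_iff_neq_zero)
    ultimately show False by simp
  qed
  moreover have "(LINT y|lborel. bump 1 x e y) \<ge> 0"
    by (intro integral_nonneg_AE) (simp add: bump_nonneg)
  ultimately show ?thesis by linarith
qed

text \<open>The quotient is a weighted average of u over the e-ball about x. Taking the mass at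
  centre 0 makes the normalisation a constant factor, compatible with
  \<open>has_laplacian_cmult\<close>.\<close>

lemma mollify_approx:
  fixes u :: "'a::euclidean_space \<Rightarrow> real"
  assumes u: "continuous_on UNIV u" and e: "e > 0"
    and close: "\<And>y. dist y x \<le> e \<Longrightarrow> \<bar>u y - u x\<bar> \<le> \<omega>"
  shows "\<bar>mollify u e x / (LINT y|lborel. bump 1 0 e (y::'a)) - u x\<bar> \<le> \<omega>"
proof -
  define N where "N = (LINT y|lborel. bump 1 x e y)"
  have N: "N > 0" "N = (LINT y|lborel. bump 1 0 e (y::'a))"
    unfolding N_def by (rule integral_bump_pos[OF e], rule integral_bump_translate)
  note int = integrable_times_bump[OF u e, of 1 x] integrable_bump[OF e, of 1 x]
  have "mollify u e x - u x * N = (LINT y|lborel. u y * bump 1 x e y - u x * bump 1 x e y)"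
    using int by (simp add: mollify_def N_def)
  also have "\<bar>\<dots>\<bar> \<le> (LINT y|lborel. \<omega> * bump 1 x e y)"
    unfolding real_norm_def[symmetric]
  proof (rule order.trans[OF integral_norm_bound integral_mono])
    show "integrable lborel (\<lambda>y. norm (u y * bump 1 x e y - u x * bump 1 x e y))"
      using int by simp
    show "integrable lborel (\<lambda>y. \<omega> * bump 1 x e y)"
      using int by simp
    fix y
    show "norm (u y * bump 1 x e y - u x * bump 1 x e y) \<le> \<omega> * bump 1 x e y"
    proof (cases "dist y x \<le> e")
      case True
      have "norm (u y * bump 1 x e y - u x * bump 1 x e y) = \<bar>u y - u x\<bar> * bump 1 x e y"
        by (simp add: abs_mult bump_nonneg flip: left_diff_distrib)
      also have "\<dots> \<le> \<omega> * bump 1 x e y"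
        by (intro mult_right_mono close True bump_nonneg)
      finally show ?thesis .
    next
      case False
      then show ?thesis using e by (simp add: bump_eq_0 dist_norm)
    qed
  qed
  also have "\<dots> = \<omega> * N" using int by (simp add: N_def)
  finally have "\<bar>mollify u e x - u x * N\<bar> / N \<le> \<omega>"
    using N by (simp add: divide_le_eq)
  then show ?thesis
    unfolding N(2)[symmetric] using N(1) by (simp add: abs_if field_simps split: if_splits)
qed

text \<open>A continuous function \<open>u\<close> with \<open>\<Delta> u \<ge> K u\<close> on \<open>D\<close> in the sense of distributions,
  where only the radial test functions are used.\<close>

definition subsolution :: "real \<Rightarrow> 'a::euclidean_space set \<Rightarrow> ('a \<Rightarrow> real) \<Rightarrow> bool" where
  "subsolution K D u \<longleftrightarrow> continuous_on UNIV u \<and> (\<forall>x e. e > 0 \<longrightarrow> cball x e \<subseteq> D \<longrightarrow>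
     (LINT y|lborel. u y * bump_laplacian x e y) \<ge> K * (LINT y|lborel. u y * bump 1 x e y))"

text \<open>If u - v had a maximum m > 0, the normalised mollification U of u would be so close to u
  that U - v attains its maximum at an interior z. There its Laplacian is at most 0, while \<Delta>
  U \<ge> K U (the bump about z is admissible) and \<Delta> v \<le> K v, so K (U - v) \<le> 0; yet U
  - v is positive at z.\<close>

lemma comparison:
  fixes u v :: "'a::euclidean_space \<Rightarrow> real"
  assumes D: "open D" "bounded D" and "K > 0" and sub: "subsolution K D u"
    and v: "continuous_on (closure D) v"
    and super: "\<And>z. z \<in> D \<Longrightarrow> \<exists>L. has_laplacian v z L \<and> L \<le> K * v z"
    and boundary: "\<And>z. z \<in> frontier D \<Longrightarrow> u z \<le> v z"
    and "x \<in> closure D"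
  shows "u x \<le> v x"
proof (rule ccontr)
  assume "\<not> u x \<le> v x"
  have u: "continuous_on UNIV u" using sub by (simp add: subsolution_def)
  have cl: "compact (closure D)" using D(2) by simp
  have uv: "continuous_on (closure D) (\<lambda>z. u z - v z)"
    using u v by (auto intro!: continuous_intros intro: continuous_on_subset)
  obtain p where p: "p \<in> closure D" "\<And>z. z \<in> closure D \<Longrightarrow> u z - v z \<le> u p - v p"
    using continuous_attains_sup[OF cl _ uv] \<open>x \<in> closure D\<close> by force
  define m where "m = u p - v p"
  have "m > 0" using p(2)[OF \<open>x \<in> closure D\<close>] \<open>\<not> u x \<le> v x\<close> by (simp add: m_def)
  \<comment> \<open>As u \<le> v on the frontier, this set is compact inside \<open>D\<close>, so
    balls of one radius \<open>e0\<close> about all its points stay in \<open>D\<close>.\<close>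
  define A where "A = {z \<in> closure D. m / 2 \<le> u z - v z}"
  have "A = closure D \<inter> (\<lambda>z. u z - v z) -` {m / 2..}" by (auto simp: A_def)
  then have "closed A" using continuous_closed_preimage[OF uv, of "{m / 2..}"] by simp
  moreover have "bounded A" using compact_imp_bounded[OF cl] by (rule bounded_subset) (auto simp: A_def)
  ultimately have "compact A" by (simp add: compact_eq_bounded_closed)
  moreover have "A \<subseteq> D"
  proof
    fix z assume z: "z \<in> A"
    then have "z \<notin> frontier D" using boundary[of z] \<open>m > 0\<close> by (auto simp: A_def)
    then show "z \<in> D" using z D(1) by (auto simp: A_def frontier_def interior_open)
  qed
  ultimately obtain e0 where e0: "e0 > 0" "(\<Union>z\<in>A. cball z e0) \<subseteq> D"
    using compact_subset_open_imp_cball_epsilon_subset[OF _ D(1), of A] by auto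
  obtain R where R: "\<And>z. z \<in> closure D \<Longrightarrow> norm z \<le> R"
    using compact_imp_bounded[OF cl] unfolding bounded_iff by auto
  \<comment> \<open>Averages over e-balls with e \<le> 1 reach points at distance up to 1 from the
    closure of \<open>D\<close>.\<close>
  have "uniformly_continuous_on (cball 0 (R + 1)) u"
    using u by (intro compact_uniformly_continuous) (auto intro: continuous_on_subset)
  then obtain d where d: "d > 0" "\<And>y z. y \<in> cball 0 (R + 1) \<Longrightarrow> z \<in> cball 0 (R + 1) \<Longrightarrow>
      dist y z < d \<Longrightarrow> dist (u y) (u z) < m / 8"
    using \<open>m > 0\<close> by (elim uniformly_continuous_onE[of _ _ "m / 8"]) (auto simp: dist_commute)
  define e where "e = min e0 (min (d / 2) 1)"
  have e: "e > 0" "e \<le> e0" "e < d" "e \<le> 1" using e0(1) d(1) by (auto simp: e_def)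
  define N where "N = (LINT y|lborel. bump 1 0 e (y::'a))"
  have "N > 0" unfolding N_def by (rule integral_bump_pos[OF e(1)])
  define U where "U z = 1 / N * mollify u e z" for z
  have approx: "\<bar>U z - u z\<bar> \<le> m / 8" if z: "z \<in> closure D" for z
  proof -
    have "\<bar>u y - u z\<bar> \<le> m / 8" if "dist y z \<le> e" for y
    proof -
      have "norm y \<le> norm z + dist y z" by (metis dist_norm norm_triangle_sub)
      then have "dist (u y) (u z) < m / 8"
        using that e R[OF z] by (intro d(2)) auto
      then show ?thesis by (simp add: dist_real_def)
    qed
    from mollify_approx[OF u e(1) this] show ?thesis by (simp add: U_def N_def)
  qed
  have "continuous_on (closure D) (\<lambda>z. U z - v z)"
    unfolding U_def
    by (intro continuous_intros v continuous_on_subset[OF continuous_mollify[OF u e(1)]]) auto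
  then obtain z where z: "z \<in> closure D" "\<And>y. y \<in> closure D \<Longrightarrow> U y - v y \<le> U z - v z"
    using continuous_attains_sup[OF cl, of "\<lambda>z. U z - v z"] \<open>x \<in> closure D\<close> by force
  \<comment> \<open>Replacing u by U costs m/8 at p, leaving 7m/8; going back at z costs another
    m/8, leaving 3m/4, enough for z to lie in \<open>A\<close>.\<close>
  have Uz: "U z - v z \<ge> 7 * m / 8"
    using z(2)[OF p(1)] approx[OF p(1)] m_def by linarith
  then have "z \<in> A"
    using z(1) approx[OF z(1)] \<open>m > 0\<close> unfolding A_def mem_Collect_eq by linarith
  with e0 e have "cball z e \<subseteq> D" and "z \<in> D" using \<open>A \<subseteq> D\<close> by (fastforce, blast)
  obtain L where L: "has_laplacian v z L" "L \<le> K * v z" using super[OF \<open>z \<in> D\<close>] by blast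
  define M where "M = 1 / N * (LINT y|lborel. u y * bump_laplacian z e y)"
  have "has_laplacian (\<lambda>y. U y - v y) z (M - L)"
    unfolding U_def M_def
    by (intro has_laplacian_diff has_laplacian_cmult has_laplacian_mollify u e(1) L(1))
  moreover obtain r where "r > 0" "ball z r \<subseteq> closure D"
    using D(1) \<open>z \<in> D\<close> closure_subset by (metis open_contains_ball subset_trans)
  ultimately have "M - L \<le> 0"
    using z(2) by (intro has_laplacian_local_max[of r z "\<lambda>y. U y - v y"]) auto
  have "K * mollify u e z \<le> (LINT y|lborel. u y * bump_laplacian z e y)"
    using sub e(1) \<open>cball z e \<subseteq> D\<close> by (simp add: subsolution_def mollify_def)
  then have "K * U z \<le> M"
    using \<open>N > 0\<close> by (simp add: U_def M_def divide_right_mono)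
  then have "K * (U z - v z) \<le> 0"
    using \<open>M - L \<le> 0\<close> L(2) by (simp add: right_diff_distrib)
  moreover have "K * (U z - v z) > 0"
    using \<open>K > 0\<close> Uz \<open>m > 0\<close> by simp
  ultimately show False by simp
qed

section \<open>Barriers\<close>

text \<open>In the radius r, exp (-\<nu> r) has Laplacian (\<nu>^2 - \<nu> (d - 1) / r) exp (-\<nu>
  r), at least K times itself for r > s by the choice of \<nu>. Subtracting exp (-\<nu> R) makes the
  barrier vanish on the outer sphere, where only u \<ge> 0 is known, and helps the inequality since
  K > 0.\<close>

lemma annulus_lower_bound:
  fixes a x :: "'a::euclidean_space"
  assumes "s > 0" "K > 0" "m \<ge> 0" "\<nu> > 0"
    and sub: "subsolution K (ball a R - cball a s) (\<lambda>y. - u y)"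
    and \<nu>: "K \<le> \<nu>\<^sup>2 - \<nu> * (real DIM('a) - 1) / s"
    and inner: "\<And>y. norm (y - a) = s \<Longrightarrow> m \<le> u y"
    and outer: "\<And>y. norm (y - a) = R \<Longrightarrow> 0 \<le> u y"
    and x: "s < norm (x - a)" "norm (x - a) < R"
  shows "m * (exp (- \<nu> * norm (x - a)) - exp (- \<nu> * R)) \<le> u x"
proof -
  define D where "D = ball a R - cball a s"
  \<comment> \<open>The barrier is negated because \<open>comparison\<close> is applied to -u, and
    written in the squared radius for \<open>has_laplacian_radial\<close>; \<open>G'\<close> and
    \<open>G2\<close> are its derivatives.\<close>
  define G where "G t = - m * (exp (- \<nu> * sqrt t) - exp (- \<nu> * R))" for t
  define G' where "G' t = m * \<nu> / (2 * sqrt t) * exp (- \<nu> * sqrt t)" for t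
  define G2 where "G2 t = - m * (\<nu>\<^sup>2 / (4 * t) + \<nu> / (4 * t * sqrt t)) * exp (- \<nu> * sqrt t)" for t
  have D: "open D" "bounded D"
    by (auto simp: D_def bounded_diff open_Diff)
  have cl: "closure D \<subseteq> cball a R - ball a s"
    by (rule closure_minimal) (auto simp: D_def closed_Diff)
  have fr: "norm (z - a) = s \<or> norm (z - a) = R" if "z \<in> frontier D" for z
    using that cl D(1) by (auto simp: D_def frontier_def interior_open dist_norm norm_minus_commute)
  have "- u x \<le> G ((norm (x - a))\<^sup>2)"
  proof (rule comparison[OF D \<open>K > 0\<close> sub[folded D_def], where v="\<lambda>y. G ((norm (y - a))\<^sup>2)"])
    show "continuous_on (closure D) (\<lambda>y. G ((norm (y - a))\<^sup>2))"
      unfolding G_def by (intro continuous_intros)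
    show "x \<in> closure D"
      using x closure_subset[of D] by (auto simp: D_def dist_norm norm_minus_commute)
  next
    fix z assume "z \<in> D"
    define r where "r = norm (z - a)"
    have r: "s < r" "r > 0" using \<open>z \<in> D\<close> \<open>s > 0\<close> by (auto simp: D_def r_def dist_norm norm_minus_commute)
    have "has_laplacian (\<lambda>y. G ((norm (y - a))\<^sup>2)) z (4 * (norm (z - a))\<^sup>2 * G2 ((norm (z - a))\<^sup>2) + 2 * DIM('a) * G' ((norm (z - a))\<^sup>2))"
    proof (rule has_laplacian_radial)
      show "open {0::real<..}" by simp
      show "(norm (z - a))\<^sup>2 \<in> {0<..}" using r by (simp add: r_def)
      show "(G has_real_derivative G' t) (at t)" if "t \<in> {0<..}" for t
        using that unfolding G_def G'_def by (auto intro!: derivative_eq_intros simp: field_simps)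
      have "(G' has_real_derivative G2 t) (at t)" if "t > 0" for t
      proof -
        have *: "sqrt t * (sqrt t * c) = t * c" for c
          using that by (simp flip: mult.assoc)
        show ?thesis
          using that unfolding G'_def G2_def
          by (auto intro!: derivative_eq_intros simp: field_simps power2_eq_square *)
      qed
      then show "(G' has_real_derivative G2 ((norm (z - a))\<^sup>2)) (at ((norm (z - a))\<^sup>2))"
        using r by (simp add: r_def)
    qed
    moreover have "4 * r\<^sup>2 * G2 (r\<^sup>2) + 2 * DIM('a) * G' (r\<^sup>2)
        = - m * (\<nu>\<^sup>2 - \<nu> * (real DIM('a) - 1) / r) * exp (- \<nu> * r)"
      using r by (simp add: G2_def G'_def field_simps power2_eq_square)
    moreover have "\<dots> \<le> - m * K * (exp (- \<nu> * r) - exp (- \<nu> * R))"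
    proof -
      have "real DIM('a) \<ge> 1" using DIM_positive[where 'a='a] by linarith
      then have "\<nu> * (real DIM('a) - 1) / r \<le> \<nu> * (real DIM('a) - 1) / s"
        using r \<open>s > 0\<close> \<open>\<nu> > 0\<close> by (intro divide_left_mono) auto
      then have "K \<le> \<nu>\<^sup>2 - \<nu> * (real DIM('a) - 1) / r" using \<nu> by simp
      then have "K * (exp (- \<nu> * r) - exp (- \<nu> * R)) \<le> (\<nu>\<^sup>2 - \<nu> * (real DIM('a) - 1) / r) * exp (- \<nu> * r)"
        using \<open>K > 0\<close> by (intro order.trans[OF mult_left_mono mult_right_mono]) auto
      from mult_left_mono[OF this \<open>m \<ge> 0\<close>] show ?thesis
        by (simp only: mult.assoc mult_minus_left neg_le_iff_le)
    qed
    ultimately show "\<exists>L. has_laplacian (\<lambda>y. G ((norm (y - a))\<^sup>2)) z L \<and> L \<le> K * G ((norm (z - a))\<^sup>2)"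
      by (auto simp: r_def G_def mult_ac)
  next
    fix z assume "z \<in> frontier D"
    then consider "norm (z - a) = s" | "norm (z - a) = R" using fr by blast
    then show "- u z \<le> G ((norm (z - a))\<^sup>2)"
    proof cases
      case 1
      have "exp (- \<nu> * s) - exp (- \<nu> * R) \<le> 1"
        using \<open>\<nu> > 0\<close> \<open>s > 0\<close> by (intro order.trans[OF _ exp_le_one_iff[THEN iffD2, of "- \<nu> * s"]]) auto
      from mult_left_mono[OF this \<open>m \<ge> 0\<close>] inner[OF 1] 1 \<open>s > 0\<close> show ?thesis by (simp add: G_def)
    next
      case 2
      then show ?thesis using outer[OF 2] x \<open>s > 0\<close> by (simp add: G_def)
    qed
  qed
  then show ?thesis by (simp add: G_def)
qed

text \<open>The barrier uses sqrt (1 + |y - a|^2) instead of |y - a| to be smooth at the centre,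
  where the bound is read off; the price is the factor exp \<nu>. Its Laplacian is at most \<nu>^2 +
  d \<nu> times itself.\<close>

lemma ball_upper_bound:
  fixes a :: "'a::euclidean_space"
  assumes "R > 0" "K > 0" "M \<ge> 0" "\<nu> > 0"
    and sub: "subsolution K (ball a R) u"
    and \<nu>: "\<nu>\<^sup>2 + real DIM('a) * \<nu> \<le> K"
    and bound: "\<And>y. norm (y - a) = R \<Longrightarrow> u y \<le> M"
  shows "u a \<le> M * exp (\<nu> - \<nu> * R)"
proof -
  define G where "G t = M * exp (\<nu> * (sqrt (1 + t) - R))" for t
  define G' where "G' t = \<nu> / (2 * sqrt (1 + t)) * G t" for t
  define G2 where "G2 t = (\<nu>\<^sup>2 / (4 * (1 + t)) - \<nu> / (4 * (1 + t) * sqrt (1 + t))) * G t" for t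
  have "u a \<le> G ((norm (a - a))\<^sup>2)"
  proof (rule comparison[OF open_ball bounded_ball \<open>K > 0\<close> sub, where v="\<lambda>y. G ((norm (y - a))\<^sup>2)"])
    show "continuous_on (closure (ball a R)) (\<lambda>y. G ((norm (y - a))\<^sup>2))"
      unfolding G_def by (intro continuous_intros)
    show "a \<in> closure (ball a R)" using \<open>R > 0\<close> by simp
  next
    fix z
    define t where "t = (norm (z - a))\<^sup>2"
    have t: "t \<ge> 0" by (simp add: t_def)
    have "has_laplacian (\<lambda>y. G ((norm (y - a))\<^sup>2)) z (4 * (norm (z - a))\<^sup>2 * G2 t + 2 * DIM('a) * G' ((norm (z - a))\<^sup>2))"
    proof (rule has_laplacian_radial)
      \<comment> \<open>Starting at -1 makes t = 0, the centre of the ball, an interior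
        point.\<close>
      show "open {-1::real<..}" by simp
      show "(norm (z - a))\<^sup>2 \<in> {-1<..}" using t unfolding t_def greaterThan_iff by linarith
      show dG: "(G has_real_derivative G' t) (at t)" if "t \<in> {-1<..}" for t
        using that unfolding G_def G'_def by (auto intro!: derivative_eq_intros simp: field_simps)
      have "((\<lambda>t. \<nu> / (2 * sqrt (1 + t))) has_real_derivative - \<nu> / (4 * (1 + t) * sqrt (1 + t))) (at t)"
        using t by (auto intro!: derivative_eq_intros simp: field_simps)
      then have "(G' has_real_derivative - \<nu> / (4 * (1 + t) * sqrt (1 + t)) * G t + G' t * (\<nu> / (2 * sqrt (1 + t)))) (at t)"
        unfolding G'_def[abs_def] using dG[of t] t
        by (intro DERIV_mult) (auto simp: G'_def)
      moreover have "G' t * (\<nu> / (2 * sqrt (1 + t))) = \<nu>\<^sup>2 / (4 * (1 + t)) * G t"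
        using t by (simp add: G'_def power2_eq_square)
      ultimately show "(G' has_real_derivative G2 t) (at ((norm (z - a))\<^sup>2))"
        by (simp add: G2_def t_def algebra_simps)
    qed
    moreover have "4 * t * G2 t + 2 * DIM('a) * G' t \<le> K * G t"
    proof -
      have *: "4 * t * ((\<nu>\<^sup>2 / (4 * p) - \<nu> / (4 * p * q)) * c) + 2 * d * (\<nu> / (2 * q) * c)
          = (\<nu>\<^sup>2 * (t / p) - \<nu> * t / (p * q) + d * \<nu> * (1 / q)) * c"
        if "p > 0" "q > 0" for p q c d :: real
        using that by (simp add: field_simps)
      have "4 * t * G2 t + 2 * DIM('a) * G' t
        = (\<nu>\<^sup>2 * (t / (1 + t)) - \<nu> * t / ((1 + t) * sqrt (1 + t)) + real DIM('a) * \<nu> * (1 / sqrt (1 + t))) * G t"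
        unfolding G2_def G'_def of_nat_mult of_nat_numeral using t by (intro *) auto
      also have "\<dots> \<le> (\<nu>\<^sup>2 * 1 - 0 + real DIM('a) * \<nu> * 1) * G t"
        using t \<open>\<nu> > 0\<close> \<open>M \<ge> 0\<close>
        by (intro mult_right_mono add_mono diff_mono mult_left_mono divide_nonneg_nonneg mult_nonneg_nonneg)
           (auto simp: G_def divide_le_eq)
      also have "\<dots> \<le> K * G t"
        using \<nu> \<open>M \<ge> 0\<close> by (intro mult_right_mono) (auto simp: G_def)
      finally show ?thesis .
    qed
    ultimately show "\<exists>L. has_laplacian (\<lambda>y. G ((norm (y - a))\<^sup>2)) z L \<and> L \<le> K * G ((norm (z - a))\<^sup>2)"
      unfolding t_def by blast
  next
    fix z assume "z \<in> frontier (ball a R)"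
    then have z: "norm (z - a) = R" using \<open>R > 0\<close> by (simp add: dist_norm norm_minus_commute)
    have "R \<le> sqrt (1 + R\<^sup>2)" using \<open>R > 0\<close> by (intro real_le_rsqrt) auto
    then have "M * 1 \<le> G (R\<^sup>2)"
      unfolding G_def using \<open>M \<ge> 0\<close> \<open>\<nu> > 0\<close> by (intro mult_left_mono) auto
    with bound[OF z] z show "u z \<le> G ((norm (z - a))\<^sup>2)" by simp
  qed
  then show ?thesis by (simp add: G_def algebra_simps)
qed

section \<open>The eigenvalue equation tested against bumps\<close>

lemma schrodinger_bump_identity:
  fixes \<phi> V :: "'a::euclidean_space \<Rightarrow> real"
  assumes eq: "schrodinger V (\<lambda>x. of_real (\<phi> x)) (\<lambda>x. of_real l * of_real (\<phi> x))"
    and \<phi>: "continuous_on UNIV \<phi>" and V: "V \<in> borel_measurable borel"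
    and bound: "\<And>y. y \<in> cball x e \<Longrightarrow> \<bar>V y\<bar> \<le> B" and "e > 0"
  shows "integrable lborel (\<lambda>y. V y * (\<phi> y * bump 1 x e y))"
    and "(LINT y|lborel. \<phi> y * bump_laplacian x e y) = (LINT y|lborel. (V y - l) * (\<phi> y * bump 1 x e y))"
proof -
  note int = integrable_times_bump[OF \<phi> \<open>e > 0\<close>, of 1 x] integrable_times_bump_laplacian[OF \<phi> \<open>e > 0\<close>, of x]
  show intV: "integrable lborel (\<lambda>y. V y * (\<phi> y * bump 1 x e y))"
  proof (rule Bochner_Integration.integrable_bound)
    show "integrable lborel (\<lambda>y. B * (\<phi> y * bump 1 x e y))" using int by simp
    show "(\<lambda>y. V y * (\<phi> y * bump 1 x e y)) \<in> borel_measurable lborel"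
      using V borel_measurable_integrable[OF int(1)] by simp
    show "AE y in lborel. norm (V y * (\<phi> y * bump 1 x e y)) \<le> norm (B * (\<phi> y * bump 1 x e y))"
    proof (rule AE_I2)
      fix y
      show "norm (V y * (\<phi> y * bump 1 x e y)) \<le> norm (B * (\<phi> y * bump 1 x e y))"
      proof (cases "y \<in> cball x e")
        case True
        then have "\<bar>V y\<bar> \<le> \<bar>B\<bar>" using bound[of y] by simp
        then show ?thesis by (simp add: abs_mult mult_right_mono)
      next
        case False
        then show ?thesis using \<open>e > 0\<close> by (simp add: bump_eq_0 dist_norm norm_minus_commute)
      qed
    qed
  qed
  \<comment> \<open>All data are real, so the complex weak identity is the embedding of a real
    one.\<close>
  have "(LINT y|lborel. complex_of_real (\<phi> y * (- bump_laplacian x e y + V y * bump 1 x e y)))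
      = (LINT y|lborel. complex_of_real (l * \<phi> y * bump 1 x e y))"
    using eq bump_test_function[OF \<open>e > 0\<close>, of 1 x]
    unfolding schrodinger_def by (auto simp: laplacian_bump)
  then have "(LINT y|lborel. \<phi> y * (- bump_laplacian x e y + V y * bump 1 x e y))
      = (LINT y|lborel. l * \<phi> y * bump 1 x e y)"
    unfolding integral_complex_of_real of_real_eq_iff .
  moreover have "(LINT y|lborel. \<phi> y * (- bump_laplacian x e y + V y * bump 1 x e y))
      = (LINT y|lborel. V y * (\<phi> y * bump 1 x e y) - \<phi> y * bump_laplacian x e y)"
    by (intro Bochner_Integration.integral_cong) (auto simp: algebra_simps)
  moreover have "(LINT y|lborel. (V y - l) * (\<phi> y * bump 1 x e y))
      = (LINT y|lborel. V y * (\<phi> y * bump 1 x e y) - l * \<phi> y * bump 1 x e y)"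
    by (intro Bochner_Integration.integral_cong) (auto simp: algebra_simps)
  ultimately show "(LINT y|lborel. \<phi> y * bump_laplacian x e y) = (LINT y|lborel. (V y - l) * (\<phi> y * bump 1 x e y))"
    using int intV by (simp add: mult.assoc)
qed

section \<open>Estimates of radial eigenfunctions\<close>

locale radial_schrodinger_solution =
  fixes g :: "real \<Rightarrow> real" and V :: "'a::euclidean_space \<Rightarrow> real" and \<phi> :: "'a \<Rightarrow> real" and l :: real
  assumes g_nonneg: "\<And>r. r \<ge> 0 \<Longrightarrow> g r \<ge> 0"
    and g_increasing: "mono_on {0..} g"
    and g_unbounded: "filterlim g at_top at_top"
    and V_radial: "\<And>x. V x = g (norm x)"
    and eigen: "schrodinger V (\<lambda>x. of_real (\<phi> x)) (\<lambda>x. of_real l * of_real (\<phi> x))"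
    and \<phi>_bounded: "bounded (range \<phi>)"
    and \<phi>_continuous: "continuous_on UNIV \<phi>"
    and \<phi>_pos: "\<And>x. \<phi> x > 0"
begin

lemma g_mono: "0 \<le> r \<Longrightarrow> r \<le> s \<Longrightarrow> g r \<le> g s"
  using g_increasing by (auto simp: mono_on_def)

lemma V_measurable: "V \<in> borel_measurable borel"
proof -
  \<comment> \<open>Precomposing with \<open>max 0\<close> extends \<open>g\<close> from the half
    line to a monotone, hence Borel, function without changing \<open>V\<close>.\<close>
  have "mono (\<lambda>r. g (max 0 r))" by (intro monoI g_mono) auto
  then have "(\<lambda>r. g (max 0 r)) \<in> borel_measurable borel" by (rule borel_measurable_mono)
  then have "(\<lambda>x::'a. g (max 0 (norm x))) \<in> borel_measurable borel" by measurable
  then show ?thesis by (simp add: V_radial[abs_def])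
qed

lemma V_bounded_cball: "y \<in> cball x e \<Longrightarrow> \<bar>V y\<bar> \<le> g (norm x + e)"
proof -
  assume "y \<in> cball x e"
  then have "norm y \<le> norm x + e"
    using norm_triangle_sub[of y x] by (simp add: dist_norm norm_minus_commute)
  then show ?thesis by (simp add: V_radial g_nonneg g_mono)
qed

lemma subsolution_eigenfunction:
  assumes "\<And>y. y \<in> D \<Longrightarrow> K \<le> V y - l"
  shows "subsolution K D \<phi>"
  unfolding subsolution_def
proof (intro conjI allI impI \<phi>_continuous)
  fix x e assume e: "e > (0::real)" and sub: "cball x e \<subseteq> D"
  note id = schrodinger_bump_identity[OF eigen \<phi>_continuous V_measurable V_bounded_cball e, of x]
  note int = integrable_times_bump[OF \<phi>_continuous e, of 1 x]
  have "K * (LINT y|lborel. \<phi> y * bump 1 x e y) = (LINT y|lborel. K * (\<phi> y * bump 1 x e y))"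
    by simp
  also have "\<dots> \<le> (LINT y|lborel. (V y - l) * (\<phi> y * bump 1 x e y))"
  proof (rule integral_mono)
    show "integrable lborel (\<lambda>y. (V y - l) * (\<phi> y * bump 1 x e y))"
      using id(1) int by (simp add: left_diff_distrib)
    fix y
    show "K * (\<phi> y * bump 1 x e y) \<le> (V y - l) * (\<phi> y * bump 1 x e y)"
    proof (cases "y \<in> cball x e")
      case True
      then show ?thesis using assms sub \<phi>_pos[of y] bump_nonneg[of x e y] by (intro mult_right_mono) auto
    next
      case False
      then show ?thesis using e by (simp add: bump_eq_0 dist_norm norm_minus_commute)
    qed
  qed (use int in simp)
  finally show "K * (LINT y|lborel. \<phi> y * bump 1 x e y) \<le> (LINT y|lborel. \<phi> y * bump_laplacian x e y)"
    using id(2) by simp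
qed

text \<open>Phrased for -\<phi>, so that the same comparison principle serves lower bounds.\<close>

lemma supersolution_eigenfunction:
  assumes "\<And>y. y \<in> D \<Longrightarrow> V y - l \<le> K"
  shows "subsolution K D (\<lambda>y. - \<phi> y)"
  unfolding subsolution_def
proof (intro conjI allI impI continuous_on_minus \<phi>_continuous)
  fix x e assume e: "e > (0::real)" and sub: "cball x e \<subseteq> D"
  note id = schrodinger_bump_identity[OF eigen \<phi>_continuous V_measurable V_bounded_cball e, of x]
  note int = integrable_times_bump[OF \<phi>_continuous e, of 1 x]
  have "(LINT y|lborel. (V y - l) * (\<phi> y * bump 1 x e y)) \<le> (LINT y|lborel. K * (\<phi> y * bump 1 x e y))"
  proof (rule integral_mono)
    show "integrable lborel (\<lambda>y. (V y - l) * (\<phi> y * bump 1 x e y))"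
      using id(1) int by (simp add: left_diff_distrib)
    fix y
    show "(V y - l) * (\<phi> y * bump 1 x e y) \<le> K * (\<phi> y * bump 1 x e y)"
    proof (cases "y \<in> cball x e")
      case True
      then show ?thesis using assms sub \<phi>_pos[of y] bump_nonneg[of x e y] by (intro mult_right_mono) auto
    next
      case False
      then show ?thesis using e by (simp add: bump_eq_0 dist_norm norm_minus_commute)
    qed
  qed (use int in simp)
  then show "K * (LINT y|lborel. - \<phi> y * bump 1 x e y) \<le> (LINT y|lborel. - \<phi> y * bump_laplacian x e y)"
    using id(2) by simp
qed

text \<open>The rate comes from the annulus 1 < |y| < r about the origin; the term d - 1 in it
  offsets the first-order part of the radial Laplacian. The denominator is 1/\<rho>, the price of
  the second annulus, of radii \<rho>/2 and 2\<rho> about a point \<open>z\<close> on the segment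
  from 0 to x.\<close>

lemma eigenfunction_lower_bound:
  obtains c where "c > 0" "\<And>x. norm x \<ge> 3 \<Longrightarrow> \<phi> x \<ge> c *
    exp (- (sqrt (g (norm x) + \<bar>l\<bar> + 1) + real DIM('a) - 1) * norm x) / sqrt (g (norm x + 1) + \<bar>l\<bar> + 1)"
proof -
  define L where "L = \<bar>l\<bar> + 1"
  \<comment> \<open>The value of \<kappa> \<rho> below. It depends on the dimension only, so the
    second barrier contributes a constant factor \<open>C1\<close> at distance \<rho> from
    \<open>z\<close>.\<close>
  define \<beta> where "\<beta> = 2 * real DIM('a) - 1"
  have d: "real DIM('a) \<ge> 1" using DIM_positive[where 'a='a] by linarith
  have "compact (cball (0::'a) 1)" "cball (0::'a) 1 \<noteq> {}" by auto
  then obtain p where p: "\<And>y. y \<in> cball (0::'a) 1 \<Longrightarrow> \<phi> p \<le> \<phi> y"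
    using continuous_attains_inf[of "cball (0::'a) 1" \<phi>] \<phi>_continuous
    by (metis continuous_on_subset top_greatest)
  define c0 where "c0 = \<phi> p"
  have "c0 > 0" by (simp add: c0_def \<phi>_pos)
  define C1 where "C1 = exp (- \<beta>) - exp (- \<beta> * 2)"
  have "\<beta> > 0" unfolding \<beta>_def using d by linarith
  then have "C1 > 0" by (simp add: C1_def)
  have "\<phi> x \<ge> c0 * C1 / 2 * exp (- (sqrt (g (norm x) + L) + real DIM('a) - 1) * norm x) / sqrt (g (norm x + 1) + L)"
    if x: "norm x \<ge> 3" for x
  proof -
    define r where "r = norm x"
    have r: "r \<ge> 3" using x by (simp add: r_def)
    define K where "K = g r + L"
    define K' where "K' = g (r + 1) + L"
    have K: "K \<ge> 1" "K' \<ge> 1" using r g_nonneg[of r] g_nonneg[of "r + 1"] by (auto simp: K_def K'_def L_def)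
    \<comment> \<open>With inner radius 1 this gives \<nu>^2 - \<nu> (d - 1) = \<nu> sqrt K \<ge>
      K.\<close>
    define \<nu> where "\<nu> = sqrt K + real DIM('a) - 1"
    have "sqrt K \<ge> 1" "sqrt K' \<ge> 1" using K by auto
    then have \<nu>: "\<nu> \<ge> 1" "\<nu> \<ge> sqrt K" unfolding \<nu>_def using d by linarith+
    have \<nu>K: "K \<le> \<nu>\<^sup>2 - \<nu> * (real DIM('a) - 1) / 1"
    proof -
      have "\<nu>\<^sup>2 - \<nu> * (real DIM('a) - 1) / 1 = \<nu> * sqrt K" by (simp add: \<nu>_def power2_eq_square algebra_simps)
      also have "\<dots> \<ge> sqrt K * sqrt K" using \<nu> K by (intro mult_right_mono) auto
      finally show ?thesis using K by simp
    qed
    have outer: "c0 * (exp (- \<nu> * norm y) - exp (- \<nu> * r)) \<le> \<phi> y" if y: "1 < norm y" "norm y < r" for y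
    proof -
      have "c0 * (exp (- \<nu> * norm (y - 0)) - exp (- \<nu> * r)) \<le> \<phi> y"
      proof (rule annulus_lower_bound[where s=1 and K=K])
        show "subsolution K (ball 0 r - cball 0 1) (\<lambda>y. - \<phi> y)"
        proof (rule supersolution_eigenfunction)
          fix w :: 'a assume "w \<in> ball 0 r - cball 0 1"
          then have "g (norm w) \<le> g r" by (intro g_mono) auto
          then show "V w - l \<le> K" by (simp add: V_radial K_def L_def)
        qed
      qed (use K \<nu> \<nu>K \<open>c0 > 0\<close> y p \<phi>_pos in \<open>auto simp: c0_def less_imp_le\<close>)
      then show ?thesis by simp
    qed
    \<comment> \<open>The decay length for the constant \<open>K'\<close>. As |z| + 2\<rho> = r +
      \<rho> \<le> r + 1, the potential on the second annulus is controlled by g(r + 1).\<close>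
    define \<rho> where "\<rho> = 1 / sqrt K'"
    have \<rho>: "\<rho> > 0" "\<rho> \<le> 1" using \<open>sqrt K' \<ge> 1\<close> by (auto simp: \<rho>_def)
    define z where "z = (1 - \<rho> / r) *\<^sub>R x"
    have "x - z = (\<rho> / r) *\<^sub>R x" by (simp add: z_def algebra_simps)
    then have xz: "norm (x - z) = \<rho>" using \<rho> r by (simp add: r_def[symmetric])
    have "norm z = (1 - \<rho> / r) * r" using \<rho> r by (simp add: z_def r_def[symmetric] divide_le_eq)
    then have z: "norm z = r - \<rho>" using r by (simp add: left_diff_distrib)
    define m where "m = c0 * (exp (- \<nu> * (r - \<rho> / 2)) - exp (- \<nu> * r))"
    define \<kappa> where "\<kappa> = sqrt K' + (real DIM('a) - 1) / (\<rho> / 2)"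
    have \<kappa>: "\<kappa> \<ge> sqrt K'" using d \<rho> by (simp add: \<kappa>_def)
    then have "\<kappa> > 0" using \<open>sqrt K' \<ge> 1\<close> by linarith
    have \<kappa>\<rho>: "\<kappa> * \<rho> = \<beta>" using \<rho> \<open>sqrt K' \<ge> 1\<close> by (simp add: \<kappa>_def \<beta>_def \<rho>_def field_simps)
    have "m \<ge> 0" using \<open>c0 > 0\<close> \<rho> \<nu> by (simp add: m_def)
    have "m * (exp (- \<kappa> * norm (x - z)) - exp (- \<kappa> * (2 * \<rho>))) \<le> \<phi> x"
    proof (rule annulus_lower_bound[where s="\<rho> / 2" and K=K'])
      show "subsolution K' (ball z (2 * \<rho>) - cball z (\<rho> / 2)) (\<lambda>y. - \<phi> y)"
      proof (rule supersolution_eigenfunction)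
        fix w assume "w \<in> ball z (2 * \<rho>) - cball z (\<rho> / 2)"
        then have "norm w \<le> r + 1"
          using norm_triangle_sub[of w z] z \<rho> by (auto simp: dist_norm norm_minus_commute)
        then have "g (norm w) \<le> g (r + 1)" by (intro g_mono) auto
        then show "V w - l \<le> K'" by (simp add: V_radial K'_def L_def)
      qed
      have "\<kappa>\<^sup>2 - \<kappa> * (real DIM('a) - 1) / (\<rho> / 2) = \<kappa> * sqrt K'"
      proof -
        have "\<kappa>\<^sup>2 - \<kappa> * (real DIM('a) - 1) / (\<rho> / 2) = \<kappa> * (\<kappa> - (real DIM('a) - 1) / (\<rho> / 2))"
          by (simp only: power2_eq_square right_diff_distrib times_divide_eq_right)
        then show ?thesis unfolding \<kappa>_def by simp
      qed
      also have "\<dots> \<ge> sqrt K' * sqrt K'" using \<kappa> K by (intro mult_right_mono) auto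
      finally show "K' \<le> \<kappa>\<^sup>2 - \<kappa> * (real DIM('a) - 1) / (\<rho> / 2)" using K by simp
      fix y assume y: "norm (y - z) = \<rho> / 2"
      \<comment> \<open>This sphere lies in r - 3\<rho>/2 \<le> |y| \<le> r - \<rho>/2; r \<ge> 3
        and \<rho> \<le> 1 keep it away from the unit ball, so the first bound applies on
        it.\<close>
      have "norm y \<le> r - \<rho> / 2" "norm y > 1"
        using norm_triangle_sub[of y z] norm_triangle_sub[of z y] y z \<rho> r by (auto simp: norm_minus_commute)
      then have "c0 * (exp (- \<nu> * norm y) - exp (- \<nu> * r)) \<le> \<phi> y" using \<rho> by (intro outer) auto
      moreover have "m \<le> c0 * (exp (- \<nu> * norm y) - exp (- \<nu> * r))"
        unfolding m_def using \<open>c0 > 0\<close> \<nu> \<open>norm y \<le> r - \<rho> / 2\<close> by simp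
      ultimately show "m \<le> \<phi> y" by simp
    qed (use K \<rho> \<open>m \<ge> 0\<close> \<open>\<kappa> > 0\<close> \<phi>_pos xz in \<open>auto simp: less_imp_le\<close>)
    moreover have "exp (- \<kappa> * norm (x - z)) - exp (- \<kappa> * (2 * \<rho>)) = C1"
      unfolding C1_def \<kappa>\<rho>[symmetric] xz by (simp add: mult.assoc mult.commute[of 2])
    ultimately have "m * C1 \<le> \<phi> x" by simp
    \<comment> \<open>By exp t \<ge> 1 + t the gap between the exponentials at r - \<rho>/2 and at r
      is at least linear in \<rho>.\<close>
    moreover have "c0 / 2 * exp (- \<nu> * r) * \<rho> \<le> m"
    proof -
      have "exp (- \<nu> * (r - \<rho> / 2)) - exp (- \<nu> * r) = exp (- \<nu> * r) * (exp (\<nu> * \<rho> / 2) - 1)"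
        by (simp add: right_diff_distrib flip: exp_add)
      also have "\<dots> \<ge> exp (- \<nu> * r) * (\<rho> / 2)"
      proof (intro mult_left_mono)
        have "\<rho> / 2 \<le> \<nu> * \<rho> / 2" using \<nu> \<rho> by simp
        also have "\<dots> \<le> exp (\<nu> * \<rho> / 2) - 1" using exp_ge_add_one_self[of "\<nu> * \<rho> / 2"] by linarith
        finally show "\<rho> / 2 \<le> exp (\<nu> * \<rho> / 2) - 1" .
      qed simp
      finally have "c0 * (exp (- \<nu> * r) * (\<rho> / 2)) \<le> m"
        unfolding m_def using \<open>c0 > 0\<close> by (intro mult_left_mono) auto
      then show ?thesis by simp
    qed
    ultimately have "c0 / 2 * exp (- \<nu> * r) * \<rho> * C1 \<le> \<phi> x"
      using \<open>C1 > 0\<close> by (meson mult_right_mono less_imp_le order.trans)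
    then show ?thesis
      by (simp add: \<rho>_def \<nu>_def K_def K'_def r_def mult_ac)
  qed
  with that[of "c0 * C1 / 2"] \<open>c0 > 0\<close> \<open>C1 > 0\<close> show ?thesis by (simp add: L_def add.assoc)
qed

text \<open>The loss sqrt (g(r + 1) + L) is at most a constant times exp (p r), so all corrections
  to the exponent are linear in r and are absorbed by \<epsilon> sqrt (g r) r.\<close>

lemma lower_estimate_exponential_growth:
  assumes "C > 0" "p \<ge> 0" and growth: "\<And>r. r \<ge> r0 \<Longrightarrow> g r \<le> C * exp (p * r)"
  shows "lower_estimate V \<phi>"
  unfolding lower_estimate_def
proof (intro allI impI)
  fix \<epsilon> :: real assume \<epsilon>: "\<epsilon> > 0"
  define L where "L = \<bar>l\<bar> + 1"
  obtain c where c: "c > 0" "\<And>x. norm x \<ge> 3 \<Longrightarrow> \<phi> x \<ge> c *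
    exp (- (sqrt (g (norm x) + L) + real DIM('a) - 1) * norm x) / sqrt (g (norm x + 1) + L)"
    using eigenfunction_lower_bound unfolding L_def add.assoc by metis
  define C2 where "C2 = C * exp p + L"
  have "C2 > 0" using \<open>C > 0\<close> by (auto simp: C2_def L_def intro!: add_pos_nonneg)
  \<comment> \<open>Beyond \<open>r1\<close>, \<epsilon> sqrt (g r) exceeds the sum of the constant
    corrections to the rate.\<close>
  obtain r1 where r1: "\<And>r. r \<ge> r1 \<Longrightarrow> g r \<ge> ((sqrt L + real DIM('a) + p) / \<epsilon>)\<^sup>2"
    using g_unbounded unfolding filterlim_at_top eventually_at_top_linorder by blast
  have "\<phi> x \<ge> c / C2 * exp (- (1 + \<epsilon>) * sqrt (V x) * norm x)" if "norm x \<ge> max 3 (max r0 r1)" for x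
  proof -
    define r where "r = norm x"
    have r: "r \<ge> 3" "r \<ge> r0" "r \<ge> r1" using that by (auto simp: r_def)
    have g0: "g r \<ge> 0" "g (r + 1) \<ge> 0" using r g_nonneg by auto
    have "L \<ge> 1" by (simp add: L_def)
    have "g (r + 1) + L \<le> C * exp (p * (r + 1)) + L * exp (p * r)"
      using growth[of "r + 1"] r \<open>p \<ge> 0\<close> \<open>L \<ge> 1\<close> by (intro add_mono) auto
    also have "\<dots> = C2 * exp (p * r)" by (simp add: C2_def distrib_left distrib_right exp_add)
    finally have "g (r + 1) + L \<le> C2 * exp (p * r)" .
    \<comment> \<open>Since the argument is at least 1, its root is at most itself; the crude bound
      only affects the constant in the rate.\<close>
    moreover have "sqrt (g (r + 1) + L) \<le> g (r + 1) + L"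
      using g0 \<open>L \<ge> 1\<close> by (intro real_le_lsqrt self_le_power) auto
    ultimately have sq: "sqrt (g (r + 1) + L) \<le> C2 * exp (p * r)" by simp
    have "sqrt (g r + L) \<le> sqrt (g r) + sqrt L" using g0 \<open>L \<ge> 1\<close> by (intro sqrt_add_le_add_sqrt) auto
    moreover have "(sqrt L + real DIM('a) + p) / \<epsilon> \<le> sqrt (g r)"
      using r1[OF r(3)] by (rule real_le_rsqrt)
    then have "sqrt L + real DIM('a) + p \<le> \<epsilon> * sqrt (g r)" using \<epsilon> by (simp add: divide_le_eq mult.commute)
    ultimately have "sqrt (g r + L) + real DIM('a) - 1 + p \<le> (1 + \<epsilon>) * sqrt (g r)"
      by (simp add: distrib_right)
    then have "(sqrt (g r + L) + real DIM('a) - 1 + p) * r \<le> (1 + \<epsilon>) * sqrt (g r) * r"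
      using r by (intro mult_right_mono) auto
    then have "- (1 + \<epsilon>) * sqrt (g r) * r \<le> - (sqrt (g r + L) + real DIM('a) - 1 + p) * r"
      by (simp only: mult_minus_left neg_le_iff_le)
    then have "c / C2 * exp (- (1 + \<epsilon>) * sqrt (g r) * r) \<le> c / C2 * exp (- (sqrt (g r + L) + real DIM('a) - 1 + p) * r)"
      using c(1) \<open>C2 > 0\<close> by (intro mult_left_mono) auto
    also have "\<dots> = c * exp (- (sqrt (g r + L) + real DIM('a) - 1) * r) / (C2 * exp (p * r))"
      by (simp add: exp_diff exp_add exp_minus field_simps)
    also have "\<dots> \<le> c * exp (- (sqrt (g r + L) + real DIM('a) - 1) * r) / sqrt (g (r + 1) + L)"
      using sq c(1) g0 \<open>L \<ge> 1\<close> \<open>C2 > 0\<close> by (intro divide_left_mono) auto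
    also have "\<dots> \<le> \<phi> x" using c(2)[of x] r by (simp add: r_def)
    finally show ?thesis by (simp add: V_radial r_def)
  qed
  then show "\<exists>c>0. \<exists>r>0. \<forall>x. norm x \<ge> r \<longrightarrow> \<phi> x \<ge> c * exp (- (1 + \<epsilon>) * sqrt (V x) * norm x)"
    using c(1) \<open>C2 > 0\<close>
    by (intro exI[of _ "c / C2"] conjI exI[of _ "max 3 (max r0 r1)"] allI impI) auto
qed

text \<open>The ball of radius (1 - \<delta>) r about x stays outside the ball of radius \<delta> r
  about 0, so the condition is used with 1 - \<delta> as the shrinking parameter: g(\<delta> r)
  \<ge> (1 - \<delta>) g(r).\<close>

lemma upper_estimate_growth_condition_II:
  assumes "growth_condition_II g"
  shows "upper_estimate V \<phi>"
  unfolding upper_estimate_def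
proof (intro ballI)
  fix \<epsilon> :: real assume \<epsilon>: "\<epsilon> \<in> {0<..<1}"
  \<comment> \<open>Three losses of \<delta> occur in the rate and two in the radius, and (1 -
    3\<delta>) (1 - 2\<delta>) \<ge> 1 - 5\<delta> = 1 - \<epsilon>.\<close>
  define \<delta> where "\<delta> = \<epsilon> / 5"
  have \<delta>: "\<delta> > 0" "\<delta> < 1 / 5" using \<epsilon> by (auto simp: \<delta>_def)
  have "\<delta> \<in> {0<..<1}" "1 - \<delta> \<in> {0<..<1}" using \<delta> by auto
  with assms obtain t0 where t0: "\<And>t. t > t0 \<Longrightarrow> g ((1 - (1 - \<delta>)) * t) \<ge> (1 - \<delta>) * g t"
    unfolding growth_condition_II_def by meson
  obtain M where M: "M > 0" "\<And>x. \<phi> x \<le> M"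
    using \<phi>_bounded unfolding bounded_pos by (auto simp: abs_le_iff)
  define d where "d = real DIM('a)"
  have d: "d \<ge> 1" using DIM_positive[where 'a='a] unfolding d_def by linarith
  obtain r1 where r1: "\<And>r. r \<ge> r1 \<Longrightarrow> g r \<ge> max (\<bar>l\<bar> / \<delta>) ((d / \<delta>)\<^sup>2)"
    using g_unbounded unfolding filterlim_at_top eventually_at_top_linorder by blast
  have "\<phi> x \<le> M * exp (- (1 - \<epsilon>) * sqrt (V x) * norm x)"
    if "norm x \<ge> max (t0 + 1) (max r1 (1 / \<delta>))" for x
  proof -
    define r where "r = norm x"
    have r: "r > t0" "r \<ge> r1" "r \<ge> 1 / \<delta>" using that by (auto simp: r_def)
    then have "r * \<delta> \<ge> 1" using \<delta> by (simp add: divide_le_eq)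
    have "r > 0" using r(3) \<delta>(1) by (meson less_le_trans zero_less_divide_1_iff)
    define q where "q = sqrt (g r)"
    have "q \<ge> d / \<delta>" using r1[OF r(2)] unfolding q_def by (intro real_le_rsqrt) simp
    then have q: "\<delta> * q \<ge> d" using \<delta> by (simp add: divide_le_eq mult.commute)
    have "q > 0" using \<open>q \<ge> d / \<delta>\<close> \<delta>(1) d by (meson divide_pos_pos less_le_trans zero_less_one)
    have gq: "g r = q\<^sup>2" using \<open>r > 0\<close> by (simp add: q_def g_nonneg)
    have "\<bar>l\<bar> / \<delta> \<le> g r" using r1[OF r(2)] by simp
    then have l: "\<bar>l\<bar> \<le> \<delta> * g r" using \<delta> by (simp add: divide_le_eq mult.commute)
    \<comment> \<open>One \<delta> is lost to the growth condition and one to the eigenvalue, since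
      |l| \<le> \<delta> g(r).\<close>
    define K where "K = (1 - 2 * \<delta>) * g r"
    have "K > 0" using \<delta> \<open>q > 0\<close> by (simp add: K_def gq)
    \<comment> \<open>Then \<nu>^2 + d \<nu> = \<nu> sqrt K \<le> K; subtracting d costs the third
      \<delta> in the rate.\<close>
    define \<nu> where "\<nu> = sqrt K - d"
    have "(1 - 2 * \<delta>)\<^sup>2 \<le> 1 - 2 * \<delta>" using \<delta> by (simp add: power2_eq_square mult_left_le_one_le)
    then have "((1 - 2 * \<delta>) * q)\<^sup>2 \<le> K"
      unfolding K_def gq power_mult_distrib by (intro mult_right_mono) auto
    then have "(1 - 2 * \<delta>) * q \<le> sqrt K" by (rule real_le_rsqrt)
    then have \<nu>: "(1 - 3 * \<delta>) * q \<le> \<nu>" using q by (simp add: \<nu>_def algebra_simps)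
    have "(1 - 3 * \<delta>) * q > 0" using \<delta> \<open>q > 0\<close> by simp
    then have "\<nu> > 0" using \<nu> by linarith
    define R where "R = (1 - \<delta>) * r"
    have R: "R - 1 \<ge> (1 - 2 * \<delta>) * r" using \<open>r * \<delta> \<ge> 1\<close> by (simp add: R_def algebra_simps)
    have "\<phi> x \<le> M * exp (\<nu> - \<nu> * R)"
    proof (rule ball_upper_bound[where K=K and u=\<phi>])
      show "R > 0" using \<delta> \<open>r > 0\<close> by (simp add: R_def)
      show "K > 0" "\<nu> > 0" by fact+
      show "subsolution K (ball x R) \<phi>"
      proof (rule subsolution_eigenfunction)
        fix y assume "y \<in> ball x R"
        then have "norm y \<ge> r - R"
          using norm_triangle_sub[of x y] by (simp add: r_def dist_norm)
        then have "norm y \<ge> \<delta> * r" by (simp add: R_def algebra_simps)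
        then have "g (\<delta> * r) \<le> V y" unfolding V_radial using \<delta> \<open>r > 0\<close> by (intro g_mono) auto
        moreover have "(1 - \<delta>) * g r \<le> g (\<delta> * r)" using t0[OF r(1)] by simp
        ultimately show "K \<le> V y - l" using l by (simp add: K_def algebra_simps)
      qed
      have "\<nu>\<^sup>2 + d * \<nu> = (sqrt K - d) * sqrt K" by (simp add: \<nu>_def power2_eq_square algebra_simps)
      also have "\<dots> \<le> sqrt K * sqrt K" using \<open>K > 0\<close> d by (intro mult_right_mono) auto
      finally show "\<nu>\<^sup>2 + real DIM('a) * \<nu> \<le> K" using \<open>K > 0\<close> by (simp add: d_def)
    qed (use M in auto)
    also have "\<dots> \<le> M * exp (- ((1 - \<epsilon>) * q * r))"
    proof -
      have "(1 - \<epsilon>) * (q * r) \<le> ((1 - 3 * \<delta>) * (1 - 2 * \<delta>)) * (q * r)"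
        using \<open>q > 0\<close> \<open>r > 0\<close> by (intro mult_right_mono) (auto simp: \<delta>_def field_simps)
      also have "\<dots> = ((1 - 3 * \<delta>) * q) * ((1 - 2 * \<delta>) * r)" by (simp only: mult_ac)
      also have "\<dots> \<le> \<nu> * (R - 1)"
        using \<nu> R \<delta> \<open>q > 0\<close> \<open>r > 0\<close> \<open>\<nu> > 0\<close> by (intro mult_mono) auto
      finally have "\<nu> - \<nu> * R \<le> - ((1 - \<epsilon>) * q * r)" by (simp add: right_diff_distrib mult.assoc)
      then show ?thesis using M(1) by (intro mult_left_mono) auto
    qed
    finally show ?thesis unfolding q_def r_def V_radial mult_minus_left .
  qed
  then show "\<exists>c>0. \<exists>r>0. \<forall>x. norm x \<ge> r \<longrightarrow> \<phi> x \<le> c * exp (- (1 - \<epsilon>) * sqrt (V x) * norm x)"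
    using M(1) \<delta>(1)
    by (intro exI[of _ M] conjI exI[of _ "max (t0 + 1) (max r1 (1 / \<delta>))"] allI impI) (auto simp: less_max_iff_disj)
qed

lemma log_asymptotics:
  assumes "lower_estimate V \<phi>" "upper_estimate V \<phi>"
  shows "((\<lambda>x. - ln (\<phi> x) / (sqrt (V x) * norm x)) \<longlongrightarrow> 1) at_infinity"
proof (rule tendstoI)
  fix e :: real assume "e > 0"
  \<comment> \<open>Half of e pays for the estimates themselves, the other half for the logarithms
    of their constants.\<close>
  define \<epsilon> where "\<epsilon> = min e (1 / 2) / 2"
  have \<epsilon>: "\<epsilon> > 0" "\<epsilon> < 1" "2 * \<epsilon> \<le> e" using \<open>e > 0\<close> by (auto simp: \<epsilon>_def)
  obtain c r where c: "c > 0" "\<And>x. norm x \<ge> r \<Longrightarrow> \<phi> x \<ge> c * exp (- (1 + \<epsilon>) * sqrt (V x) * norm x)"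
    using assms(1) \<epsilon> unfolding lower_estimate_def by meson
  have "\<epsilon> \<in> {0<..<1}" using \<epsilon> by simp
  then obtain C s where C: "C > 0" "\<And>x. norm x \<ge> s \<Longrightarrow> \<phi> x \<le> C * exp (- (1 - \<epsilon>) * sqrt (V x) * norm x)"
    using assms(2) unfolding upper_estimate_def by meson
  obtain r1 where r1: "\<And>r. r \<ge> r1 \<Longrightarrow> g r \<ge> 1"
    using g_unbounded unfolding filterlim_at_top eventually_at_top_linorder by blast
  \<comment> \<open>From here on \<epsilon> \<rho> exceeds both logarithms, as \<rho> \<ge> |x| once
    V \<ge> 1; the summand 1 makes the inequality strict.\<close>
  define B where "B = (\<bar>ln c\<bar> + \<bar>ln C\<bar> + 1) / \<epsilon>"
  have "dist (- ln (\<phi> x) / (sqrt (V x) * norm x)) 1 < e"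
    if x: "norm x \<ge> max (max r s) (max r1 B)" for x
  proof -
    define \<rho> where "\<rho> = sqrt (V x) * norm x"
    have "sqrt (V x) \<ge> 1" using r1[of "norm x"] x by (simp add: V_radial)
    then have "1 * norm x \<le> \<rho>" unfolding \<rho>_def by (intro mult_right_mono) auto
    then have "B \<le> \<rho>" using x by simp
    then have \<rho>: "\<bar>ln c\<bar> + \<bar>ln C\<bar> + 1 \<le> \<epsilon> * \<rho>" using \<epsilon> by (simp add: B_def divide_le_eq mult.commute)
    then have "\<epsilon> * \<rho> > 0" by linarith
    then have "\<rho> > 0" using \<epsilon> by (simp add: zero_less_mult_iff)
    have "ln (c * exp (- (1 + \<epsilon>) * \<rho>)) \<le> ln (\<phi> x)"
      using c(2)[of x] c(1) x \<phi>_pos[of x] by (subst ln_le_cancel_iff) (auto simp: \<rho>_def mult.assoc)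
    then have 1: "ln c - (1 + \<epsilon>) * \<rho> \<le> ln (\<phi> x)" using c(1) by (simp add: ln_mult algebra_simps)
    have "ln (\<phi> x) \<le> ln (C * exp (- (1 - \<epsilon>) * \<rho>))"
      using C(2)[of x] C(1) x \<phi>_pos[of x] by (subst ln_le_cancel_iff) (auto simp: \<rho>_def mult.assoc)
    then have 2: "ln (\<phi> x) \<le> ln C - (1 - \<epsilon>) * \<rho>" using C(1) by (simp add: ln_mult algebra_simps)
    have "\<bar>- ln (\<phi> x) - \<rho>\<bar> < 2 * (\<epsilon> * \<rho>)"
      using 1 2 \<rho> unfolding distrib_right left_diff_distrib mult_1 by linarith
    then have "\<bar>- ln (\<phi> x) - \<rho>\<bar> < 2 * \<epsilon> * \<rho>" by (simp only: mult.assoc)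
    also have "\<dots> \<le> e * \<rho>" using \<epsilon>(3) \<open>\<rho> > 0\<close> by (intro mult_right_mono) auto
    finally have "\<bar>- ln (\<phi> x) - \<rho>\<bar> / \<rho> < e" using \<open>\<rho> > 0\<close> by (simp add: divide_less_eq)
    moreover have "\<bar>- ln (\<phi> x) / \<rho> - 1\<bar> = \<bar>- ln (\<phi> x) - \<rho>\<bar> / \<rho>"
      using \<open>\<rho> > 0\<close> by (simp add: abs_if field_simps)
    ultimately show ?thesis by (simp add: dist_real_def \<rho>_def)
  qed
  then show "\<forall>\<^sub>F x in at_infinity. dist (- ln (\<phi> x) / (sqrt (V x) * norm x)) 1 < e"
    unfolding eventually_at_infinity by blast
qed

text \<open>The case \<epsilon> = 1 says that stretching by 1 + \<delta> at most doubles
  \<open>g\<close>. Iteration limits the growth, and Bernoulli's inequality turns this into an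
  exponential bound.\<close>

lemma lower_estimate_growth_condition_I:
  assumes "growth_condition_I g"
  shows "lower_estimate V \<phi>"
proof -
  obtain \<delta> t0 where \<delta>: "\<delta> > 0" "t0 > 0" "\<And>t. t > t0 \<Longrightarrow> g ((1 + \<delta>) * t) \<le> (1 + 1) * g t"
    using assms unfolding growth_condition_I_def by (meson zero_less_one)
  define t1 where "t1 = t0 + 1"
  have t1: "t1 > t0" "t1 > 0" using \<delta> by (auto simp: t1_def)
  have iter: "g ((1 + \<delta>) ^ n * t1) \<le> 2 ^ n * g t1" for n
  proof (induction n)
    case (Suc n)
    have "1 * t1 \<le> (1 + \<delta>) ^ n * t1" using \<delta> t1 by (intro mult_right_mono one_le_power) auto
    then have "g ((1 + \<delta>) * ((1 + \<delta>) ^ n * t1)) \<le> (1 + 1) * g ((1 + \<delta>) ^ n * t1)"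
      using t1 by (intro \<delta>(3)) linarith
    also have "\<dots> \<le> 2 * (2 ^ n * g t1)" using Suc.IH by simp
    finally show ?case by (simp add: mult.assoc)
  qed simp
  have "g r \<le> (2 * g t1 + 1) * exp (ln 2 / (t1 * \<delta>) * r)" if r: "r \<ge> t1" for r
  proof -
    \<comment> \<open>Chosen so that n \<delta> t1 \<ge> r, whence (1 + \<delta>)^n t1 \<ge> r by
      Bernoulli; rounding up costs the factor 2.\<close>
    define n where "n = nat \<lceil>r / (t1 * \<delta>)\<rceil>"
    have pos: "r / (t1 * \<delta>) \<ge> 0" using r t1 \<delta> by (intro divide_nonneg_nonneg mult_nonneg_nonneg) auto
    have n: "r / (t1 * \<delta>) \<le> real n" "real n \<le> r / (t1 * \<delta>) + 1"
      using pos unfolding n_def by linarith+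
    have "r \<le> real n * \<delta> * t1" using n(1) t1 \<delta> by (simp add: divide_le_eq mult_ac)
    also have "\<dots> \<le> (1 + \<delta>) ^ n * t1"
      using Bernoulli_inequality[of \<delta> n] \<delta> t1 by (intro mult_right_mono) auto
    finally have "g r \<le> g ((1 + \<delta>) ^ n * t1)" using r t1 by (intro g_mono) auto
    also have "\<dots> \<le> 2 ^ n * g t1" by (rule iter)
    also have "(2::real) ^ n = exp (real n * ln 2)" by (simp add: exp_of_nat_mult)
    also have "exp (real n * ln 2) * g t1 \<le> exp ((r / (t1 * \<delta>) + 1) * ln 2) * g t1"
      using n(2) t1 by (intro mult_right_mono) (auto intro: g_nonneg)
    also have "(r / (t1 * \<delta>) + 1) * ln 2 = ln 2 + ln 2 / (t1 * \<delta>) * r"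
      by (simp add: distrib_right)
    also have "exp (ln 2 + ln 2 / (t1 * \<delta>) * r) * g t1 = 2 * g t1 * exp (ln 2 / (t1 * \<delta>) * r)"
      by (simp add: exp_add)
    also have "\<dots> \<le> (2 * g t1 + 1) * exp (ln 2 / (t1 * \<delta>) * r)" by (intro mult_right_mono) auto
    finally show ?thesis .
  qed
  \<comment> \<open>The summand 1 keeps the constant positive even if g vanishes at
    \<open>t1\<close>.\<close>
  moreover have "2 * g t1 + 1 > 0" "ln 2 / (t1 * \<delta>) \<ge> 0" using g_nonneg[of t1] t1 \<delta> by auto
  ultimately show ?thesis by (intro lower_estimate_exponential_growth)
qed

lemma lower_estimate_linear_growth:
  assumes "g \<in> O[at_top](\<lambda>r. r)"
  shows "lower_estimate V \<phi>"
proof -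
  obtain C where C: "C > 0" "\<forall>\<^sub>F r in at_top. norm (g r) \<le> C * norm r"
    using assms by (rule landau_o.bigE)
  then obtain r0 where r0: "\<And>r. r \<ge> r0 \<Longrightarrow> \<bar>g r\<bar> \<le> C * \<bar>r\<bar>"
    unfolding eventually_at_top_linorder by auto
  have "g r \<le> C * exp (1 * r)" if "r \<ge> max r0 0" for r
  proof -
    have "g r \<le> C * r" using r0[of r] that by simp
    also have "r \<le> exp (1 * r)" using exp_ge_add_one_self[of r] unfolding mult_1 by linarith
    then have "C * r \<le> C * exp (1 * r)" using C(1) by (intro mult_left_mono) auto
    finally show ?thesis .
  qed
  with C(1) show ?thesis by (intro lower_estimate_exponential_growth[of C 1 "max r0 0"]) auto
qed

text \<open>As ln r \<le> r, the power r^\<alpha> = exp (\<alpha> ln r) is at most exp (\<alpha> r),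
  for superlinear powers too.\<close>

lemma lower_estimate_power:
  assumes "\<alpha> > 0" "a > 0" "b > 0" and g: "\<And>r. r \<ge> 0 \<Longrightarrow> g r = a * r powr \<alpha> + b"
  shows "lower_estimate V \<phi>"
proof -
  have "g r \<le> (a + b) * exp (\<alpha> * r)" if "r \<ge> 1" for r
  proof -
    have "r powr \<alpha> \<le> exp (\<alpha> * r)"
      using that \<open>\<alpha> > 0\<close> ln_le_minus_one[of r] by (simp add: powr_def)
    moreover have "1 \<le> exp (\<alpha> * r)" using that \<open>\<alpha> > 0\<close> by simp
    ultimately have "a * r powr \<alpha> + b * 1 \<le> a * exp (\<alpha> * r) + b * exp (\<alpha> * r)"
      using \<open>a > 0\<close> \<open>b > 0\<close> by (intro add_mono mult_left_mono) auto
    then show ?thesis using that by (simp add: g distrib_right)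
  qed
  with assms(1-3) show ?thesis by (intro lower_estimate_exponential_growth[of "a + b" \<alpha> 1]) auto
qed

end

section \<open>Slowly varying profiles\<close>

lemma slowly_varying_imp_growth_conditions:
  assumes "slowly_varying g" and "filterlim g at_top at_top"
  shows "growth_condition_I g" "growth_condition_II g"
proof -
  \<comment> \<open>Eventual positivity allows the inequalities between quotients to be multiplied
    by g(t).\<close>
  have pos: "\<forall>\<^sub>F t in at_top. g t > 0"
    using assms(2) by (auto simp: filterlim_at_top_dense)
  have lim: "((\<lambda>r. g (k * r) / g r) \<longlongrightarrow> 1) at_top" if "k > 0" for k
    using assms(1) that by (simp add: slowly_varying_def)
  show "growth_condition_I g"
    unfolding growth_condition_I_def
  proof (intro allI impI)
    fix \<epsilon> :: real assume "\<epsilon> > 0"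
    \<comment> \<open>The single dilation by 2, that is \<delta> = 1, serves every
      \<epsilon>.\<close>
    then have "\<forall>\<^sub>F r in at_top. g (2 * r) / g r < 1 + \<epsilon>"
      by (intro order_tendstoD(2)[OF lim]) auto
    with pos have "\<forall>\<^sub>F r in at_top. g ((1 + 1) * r) \<le> (1 + \<epsilon>) * g r"
      by eventually_elim (simp add: divide_less_eq)
    then obtain t0 where "\<And>t. t \<ge> t0 \<Longrightarrow> g ((1 + 1) * t) \<le> (1 + \<epsilon>) * g t"
      unfolding eventually_at_top_linorder by blast
    then show "\<exists>\<delta>>0. \<exists>t0>0. \<forall>t>t0. g ((1 + \<delta>) * t) \<le> (1 + \<epsilon>) * g t"
      by (intro exI[of _ 1] conjI exI[of _ "max t0 1"]) auto
  qed
  show "growth_condition_II g"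
    unfolding growth_condition_II_def
  proof (intro ballI)
    fix \<epsilon> \<delta> :: real assume \<epsilon>: "\<epsilon> \<in> {0<..<1}" and "\<delta> \<in> {0<..<1}"
    then have "\<forall>\<^sub>F r in at_top. 1 - \<epsilon> < g ((1 - \<delta>) * r) / g r"
      by (intro order_tendstoD(1)[OF lim]) auto
    with pos have "\<forall>\<^sub>F r in at_top. g ((1 - \<delta>) * r) \<ge> (1 - \<epsilon>) * g r"
      by eventually_elim (simp add: less_divide_eq)
    then obtain t0 where "\<And>t. t \<ge> t0 \<Longrightarrow> g ((1 - \<delta>) * t) \<ge> (1 - \<epsilon>) * g t"
      unfolding eventually_at_top_linorder by blast
    then show "\<exists>t0>0. \<forall>t>t0. g ((1 - \<delta>) * t) \<ge> (1 - \<epsilon>) * g t"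
      by (intro exI[of _ "max t0 1"]) auto
  qed
qed

theorem corollary1p2:
  fixes g :: "real \<Rightarrow> real"
    and V :: "'a::euclidean_space \<Rightarrow> real"
    and \<phi> :: "'a \<Rightarrow> real"
  assumes g_nonneg: "\<And>r. r \<ge> 0 \<Longrightarrow> g r \<ge> 0"
    and g_increasing: "mono_on {0..} g"
    and g_unbounded: "filterlim g at_top at_top"
    and V_radial: "\<And>x. V x = g (norm x)"
    and ground: "ground_state V \<phi>"
  shows "(growth_condition_I g \<longrightarrow> lower_estimate V \<phi>) \<and>
    (growth_condition_II g \<longrightarrow> upper_estimate V \<phi>) \<and>
    (growth_condition_I g \<and> growth_condition_II g \<longrightarrow>
       ((\<lambda>x. - ln (\<phi> x) / (sqrt (V x) * norm x)) \<longlongrightarrow> 1) at_infinity) \<and>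
    (slowly_varying g \<longrightarrow> lower_estimate V \<phi> \<and> upper_estimate V \<phi>) \<and>
    (g \<in> O[at_top](\<lambda>r. r) \<longrightarrow> lower_estimate V \<phi>) \<and>
    ((\<exists>\<alpha> a b. \<alpha> > 0 \<and> a > 0 \<and> b > 0 \<and> (\<forall>r\<ge>0. g r = a * r powr \<alpha> + b)) \<longrightarrow>
       lower_estimate V \<phi>)"
proof -
  interpret radial_schrodinger_solution g V \<phi> "spectral_bottom V"
    using assms unfolding ground_state_def by unfold_locales auto
  show ?thesis
    using lower_estimate_growth_condition_I upper_estimate_growth_condition_II log_asymptotics
      slowly_varying_imp_growth_conditions[OF _ g_unbounded] lower_estimate_linear_growth
      lower_estimate_power
    by blast
qed

end
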